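(* Let $\{(N_n,B_n,L_n)\}_{n\ge 1}$ be a sequence of Hadamard triples with $B_n\subset\{0,1,\dots,N_n-1\}$ for all $n\ge 1$. Suppose that $\{\nu_{>n}\}$ converges weakly to $\rho=\frac12(\delta_0+\delta_1)$ and that $\liminf_{n\to\infty}\#B_n<\infty$. Then the associated Cantor-Moran measure $\mu(N_n,B_n)$ is a spectral measure.
   Context: A Hadamard triple $(N,B,L)$ consists of an integer $N\ge 2$ and finite sets $B,L\subset\mathbb{Z}$ with $\#B=\#L=M\le N$ such that the matrix $H=\frac{1}{\sqrt M}\left[e^{-2\pi i bl/N}\right]_{b\in B,\,l\in L}$ is unitary. For a finite nonempty set $A\subset\mathbb{R}$, $\delta_A=\frac{1}{\#A}\sum_{a\in A}\delta_a$, where $\delta_a$ is the Dirac measure at $a$. The Cantor-Moran measure is $\mu(N_n,B_n)=\delta_{\frac{1}{N_1}B_1}\ast\delta_{\frac{1}{N_1N_2}B_2}\ast\delta_{\frac{1}{N_1N_2N_3}B_3}\ast\cdots$ (weak limit of the finite convolutions), a Borel probability measure supported in $[0,1]$. Write $\mu=\mu_n\ast\mu_{>n}$, where $\mu_n$ is the convolution of the first $n$ discrete measures and $\mu_{>n}$ is the convolution of the remaining ones, and let $\nu_{>n}(E)=\mu_{>n}\big((N_1\cdots N_n)^{-1}E\big)$ for Borel sets $E$; thus $\nu_{>n}=\delta_{\frac{1}{N_{n+1}}B_{n+1}}\ast\delta_{\frac{1}{N_{n+1}N_{n+2}}B_{n+2}}\ast\cdots$. A Borel probability measure $\mu$ on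 $\mathbb{R}$ is a spectral measure if there is a countable set $\Lambda\subset\mathbb{R}$ such that $\{e^{2\pi i\lambda x}:\lambda\in\Lambda\}$ is an orthonormal basis of $L^2(\mu)$. *)

theory Defs
  imports "HOL-Probability.Probability"
begin

section \<open>Hadamard triples\<close>

text \<open>A complex matrix with rows indexed by \<open>I\<close> and columns indexed by \<open>J\<close> is a function of two
  arguments, of which only the values on \<open>I \<times> J\<close> matter. The two conjuncts are
  \<open>H\<^sup>*H = 1\<close> and \<open>HH\<^sup>* = 1\<close>.\<close>

definition unitary_on :: "'i set \<Rightarrow> 'j set \<Rightarrow> ('i \<Rightarrow> 'j \<Rightarrow> complex) \<Rightarrow> bool" where
  "unitary_on I J H \<longleftrightarrow>
     (\<forall>j\<in>J. \<forall>j'\<in>J. (\<Sum>i\<in>I. cnj (H i j) * H i j') = (if j = j' then 1 else 0)) \<and>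
     (\<forall>i\<in>I. \<forall>i'\<in>I. (\<Sum>j\<in>J. H i j * cnj (H i' j)) = (if i = i' then 1 else 0))"

text \<open>The sets are required to be nonempty, as is implicit in the factor \<open>1/\<surd>M\<close>.\<close>

definition hadamard_triple :: "int \<Rightarrow> int set \<Rightarrow> int set \<Rightarrow> bool" where
  "hadamard_triple N B L \<longleftrightarrow>
     N \<ge> 2 \<and> finite B \<and> finite L \<and> B \<noteq> {} \<and> L \<noteq> {} \<and>
     card B = card L \<and> int (card B) \<le> N \<and>
     unitary_on B L (\<lambda>b l. complex_of_real (1 / sqrt (real (card B))) *
       exp (- 2 * complex_of_real pi * \<i> * of_int b * of_int l / of_int N))"

section \<open>Discrete measures and infinite convolutions\<close>

definition unif_measure :: "real set \<Rightarrow> real measure" where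
  "unif_measure A = distr (measure_pmf (pmf_of_set A)) borel (\<lambda>x. x)"

lemma emeasure_unif_measure:
  assumes "finite A" "A \<noteq> {}" "E \<in> sets borel"
  shows "emeasure (unif_measure A) E =
    ennreal (1 / real (card A) * (\<Sum>a\<in>A. measure (return borel a) E))"
proof -
  have "(\<Sum>a\<in>A. measure (return borel a) E) = (\<Sum>a\<in>A. indicator E a)"
    using assms(3) by (intro sum.cong) (auto simp: measure_return)
  also have "\<dots> = real (card (A \<inter> E))"
    using assms(1) by (simp add: indicator_def sum.If_cases Int_def)
  finally show ?thesis
    using assms by (simp add: unif_measure_def emeasure_distr emeasure_pmf_of_set)
qed

text \<open>\<open>fin_convolution \<xi> n\<close> is \<open>\<xi> 1 * \<dots> * \<xi> n\<close>, starting from the neutral element, the Dirac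
  measure at \<open>0\<close>. The value \<open>\<xi> 0\<close> is not used.\<close>

fun fin_convolution :: "(nat \<Rightarrow> real measure) \<Rightarrow> nat \<Rightarrow> real measure" where
  "fin_convolution \<xi> 0 = return borel 0"
| "fin_convolution \<xi> (Suc n) = convolution (fin_convolution \<xi> n) (\<xi> (Suc n))"

text \<open>The infinite convolution \<open>\<xi> 1 * \<xi> 2 * \<dots>\<close> is the weak limit of the finite convolutions. A weak
  limit is unique, so the description is meaningful whenever the limit exists.\<close>

definition inf_convolution :: "(nat \<Rightarrow> real measure) \<Rightarrow> real measure" where
  "inf_convolution \<xi> =
     (THE \<mu>. real_distribution \<mu> \<and> weak_conv_m (fin_convolution \<xi>) \<mu>)"

section \<open>Cantor-Moran measures\<close>

text \<open>Sequences of the source are indexed from \<open>1\<close>; the values \<open>N 0\<close> and \<open>B 0\<close> are never used.\<close>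

definition level_measure :: "(nat \<Rightarrow> int) \<Rightarrow> (nat \<Rightarrow> int set) \<Rightarrow> nat \<Rightarrow> real measure" where
  "level_measure N B n =
     unif_measure ((\<lambda>b. real_of_int b / real_of_int (\<Prod>i=1..n. N i)) ` B n)"

definition cantor_moran :: "(nat \<Rightarrow> int) \<Rightarrow> (nat \<Rightarrow> int set) \<Rightarrow> real measure" where
  "cantor_moran N B = inf_convolution (level_measure N B)"

text \<open>\<open>tail_measure N B n\<close> is \<open>\<mu>\<^sub>>\<^sub>n\<close>, and \<open>scaled_tail N B n\<close> is \<open>\<nu>\<^sub>>\<^sub>n\<close>: the push-forward of \<open>\<mu>\<^sub>>\<^sub>n\<close>
  under multiplication by \<open>N\<^sub>1\<cdots>N\<^sub>n\<close> gives \<open>E\<close> the mass \<open>\<mu>\<^sub>>\<^sub>n((N\<^sub>1\<cdots>N\<^sub>n)\<^sup>-\<^sup>1E)\<close>.\<close>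

definition tail_measure :: "(nat \<Rightarrow> int) \<Rightarrow> (nat \<Rightarrow> int set) \<Rightarrow> nat \<Rightarrow> real measure" where
  "tail_measure N B n = inf_convolution (\<lambda>k. level_measure N B (n + k))"

definition scaled_tail :: "(nat \<Rightarrow> int) \<Rightarrow> (nat \<Rightarrow> int set) \<Rightarrow> nat \<Rightarrow> real measure" where
  "scaled_tail N B n =
     distr (tail_measure N B n) borel (\<lambda>x. real_of_int (\<Prod>i=1..n. N i) * x)"

section \<open>Spectral measures\<close>

definition expo :: "real \<Rightarrow> real \<Rightarrow> complex" where
  "expo t x = exp (2 * complex_of_real pi * \<i> * complex_of_real t * complex_of_real x)"

text \<open>Elements of \<open>L\<^sup>2(\<mu>)\<close> are represented by functions.\<close>

definition square_integrable :: "real measure \<Rightarrow> (real \<Rightarrow> complex) \<Rightarrow> bool" where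
  "square_integrable \<mu> f \<longleftrightarrow>
     f \<in> borel_measurable \<mu> \<and> integrable \<mu> (\<lambda>x. (cmod (f x))\<^sup>2)"

definition l2_inner :: "real measure \<Rightarrow> (real \<Rightarrow> complex) \<Rightarrow> (real \<Rightarrow> complex) \<Rightarrow> complex" where
  "l2_inner \<mu> f g = (LINT x|\<mu>. f x * cnj (g x))"

text \<open>An orthonormal basis is an orthonormal family of elements of \<open>L\<^sup>2(\<mu>)\<close> whose finite linear
  combinations are dense in \<open>L\<^sup>2(\<mu>)\<close>.\<close>

definition l2_orthonormal_basis ::
    "real measure \<Rightarrow> 'i set \<Rightarrow> ('i \<Rightarrow> real \<Rightarrow> complex) \<Rightarrow> bool" where
  "l2_orthonormal_basis \<mu> I e \<longleftrightarrow>
     (\<forall>i\<in>I. square_integrable \<mu> (e i)) \<and>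
     (\<forall>i\<in>I. \<forall>j\<in>I. l2_inner \<mu> (e i) (e j) = (if i = j then 1 else 0)) \<and>
     (\<forall>f. square_integrable \<mu> f \<longrightarrow>
       (\<forall>\<epsilon>>0. \<exists>S c. finite S \<and> S \<subseteq> I \<and>
         sqrt (LINT x|\<mu>. (cmod (f x - (\<Sum>i\<in>S. c i * e i x)))\<^sup>2) < \<epsilon>))"

definition spectral_measure :: "real measure \<Rightarrow> bool" where
  "spectral_measure \<mu> \<longleftrightarrow>
     real_distribution \<mu> \<and> (\<exists>\<Lambda>. countable \<Lambda> \<and> l2_orthonormal_basis \<mu> \<Lambda> expo)"

end

theory Submission
  imports Defs
begin

text \<open>Write \<open>P n = N 1 \<cdots> N n\<close> and let \<open>\<mu>\<^sub>n\<close> be the \<open>n\<close>-th finite convolution. A spectrum \<open>\<Lambda>\<close> of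
  \<open>\<mu>\<^sub>n\<close> extends to one of \<open>\<mu>\<^sub>m\<close> for \<open>m \<ge> n\<close> by adding the sets \<open>P k \<cdot> L (k + 1)\<close>, and its elements may
  be moved by multiples of \<open>P n\<close>. If for infinitely many \<open>n\<close> these translations can be chosen such
  that the Fourier transform of \<open>\<nu>\<^sub>>\<^sub>n\<close> stays away from \<open>0\<close> near \<open>P n\<^sup>-\<^sup>1 \<Lambda>\<close>, then nothing is lost in the
  Parseval identity when passing to the limit, and the union of the spectra is a spectrum of \<open>\<mu>\<close>.

  The difficulty is that the transform of the limit \<open>\<rho>\<close> vanishes on \<open>1/2 + \<int>\<close>, so that bounded
  translations do not suffice. Instead, translations up to \<open>N (n + 1)\<close> are used: on the progression
  \<open>(x + k) / N (n + 1)\<close>, \<open>0 \<le> k < N (n + 1)\<close>, the product of the mask polynomial of \<open>B (n + 1)\<close> with the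
  transform of \<open>\<rho>\<close> is a trigonometric polynomial one of whose discrete Fourier coefficients is at
  least \<open>1 / (2 #B (n + 1))\<close>. This is bounded below along a sequence where \<open>#B (n + 1)\<close> is bounded.\<close>

section \<open>Elementary properties of the exponentials\<close>

lemma expo_eq_cis: "expo t x = cis (2 * pi * t * x)"
  by (simp add: expo_def cis_conv_exp mult_ac)

lemma norm_expo [simp]: "norm (expo t x) = 1"
  by (simp add: expo_eq_cis)

lemma expo_0 [simp]: "expo 0 x = 1" "expo t 0 = 1"
  by (simp_all add: expo_eq_cis)

lemma expo_add: "expo (s + t) x = expo s x * expo t x"
  by (simp add: expo_eq_cis cis_mult algebra_simps)

lemma expo_add_right: "expo t (x + y) = expo t x * expo t y"
  by (simp add: expo_eq_cis cis_mult algebra_simps)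

lemma cnj_expo: "cnj (expo t x) = expo (- t) x"
  by (simp add: expo_eq_cis cis_cnj)

lemma continuous_on_expo [continuous_intros]: "continuous_on A (expo t)"
  unfolding expo_def [abs_def] by (intro continuous_intros)

lemma expo_measurable [measurable]: "expo t \<in> borel_measurable borel"
  by (intro borel_measurable_continuous_onI continuous_on_expo)

section \<open>Exponential systems in \<open>L\<^sup>2\<close>\<close>

lemma cmod_add_square_le: "(cmod (a + b))\<^sup>2 \<le> 2 * (cmod a)\<^sup>2 + 2 * (cmod b)\<^sup>2"
proof -
  have "(cmod (a + b))\<^sup>2 \<le> (cmod a + cmod b)\<^sup>2"
    by (intro power_mono norm_triangle_ineq) auto
  also have "\<dots> \<le> 2 * (cmod a)\<^sup>2 + 2 * (cmod b)\<^sup>2"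
    using sum_squares_bound[of "cmod a" "cmod b"] by (simp add: power2_sum)
  finally show ?thesis .
qed

lemma square_integrable_add:
  assumes "square_integrable \<mu> f" "square_integrable \<mu> g"
  shows "square_integrable \<mu> (\<lambda>x. f x + g x)"
proof -
  have [measurable]: "f \<in> borel_measurable \<mu>" "g \<in> borel_measurable \<mu>"
    using assms by (auto simp: square_integrable_def)
  have "integrable \<mu> (\<lambda>x. 2 * (cmod (f x))\<^sup>2 + 2 * (cmod (g x))\<^sup>2)"
    using assms by (auto simp: square_integrable_def)
  then have "integrable \<mu> (\<lambda>x. (cmod (f x + g x))\<^sup>2)"
    by (rule Bochner_Integration.integrable_bound)
      (auto intro!: AE_I2 order_trans[OF cmod_add_square_le])
  then show ?thesis
    by (simp add: square_integrable_def)
qed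

lemma square_integrable_cmult:
  "square_integrable \<mu> f \<Longrightarrow> square_integrable \<mu> (\<lambda>x. c * f x)"
  by (auto simp: square_integrable_def norm_mult power_mult_distrib)

lemma square_integrable_diff:
  assumes "square_integrable \<mu> f" "square_integrable \<mu> g"
  shows "square_integrable \<mu> (\<lambda>x. f x - g x)"
  using square_integrable_add[OF assms(1) square_integrable_cmult[OF assms(2), of "-1"]] by simp

lemma square_integrable_sum:
  "(\<And>i. i \<in> S \<Longrightarrow> square_integrable \<mu> (f i)) \<Longrightarrow> square_integrable \<mu> (\<lambda>x. \<Sum>i\<in>S. f i x)"
proof (induction S rule: infinite_finite_induct)
  case (insert i S)
  then show ?case by (simp add: square_integrable_add)
qed (auto simp: square_integrable_def)

lemma (in real_distribution) square_integrable_bounded: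
  assumes "f \<in> borel_measurable M" "AE x in M. cmod (f x) \<le> K"
  shows "square_integrable M f"
proof -
  have "AE x in M. norm ((cmod (f x))\<^sup>2) \<le> K\<^sup>2"
    using assms(2) by eventually_elim (auto intro: power_mono)
  then have "integrable M (\<lambda>x. (cmod (f x))\<^sup>2)"
    using assms(1) by (intro integrable_const_bound[where B = "K\<^sup>2"]) auto
  then show ?thesis
    using assms(1) by (simp add: square_integrable_def)
qed

lemma (in real_distribution) square_integrable_expo [simp]: "square_integrable M (expo t)"
  by (rule square_integrable_bounded[where K = 1]) auto

text \<open>This is membership in the closed span of the exponentials with frequencies in
  \<open>\<Lambda>\<close>. Errors are measured by the squared norm, which behaves better under
  integrals; the square root returns only when the orthonormal basis is assembled.\<close>

definition l2_approximable :: "real measure \<Rightarrow> real set \<Rightarrow> (real \<Rightarrow> complex) \<Rightarrow> bool" where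
  "l2_approximable \<mu> \<Lambda> f \<longleftrightarrow> square_integrable \<mu> f \<and>
    (\<forall>\<epsilon>>0. \<exists>S c. finite S \<and> S \<subseteq> \<Lambda> \<and>
      (LINT x|\<mu>. (cmod (f x - (\<Sum>i\<in>S. c i * expo i x)))\<^sup>2) < \<epsilon>)"

lemma (in real_distribution) square_integrable_sum_expo:
  "square_integrable M (\<lambda>x. \<Sum>i\<in>S. c i * expo i x)"
  by (intro square_integrable_sum square_integrable_cmult square_integrable_expo)

lemma integral_cmod_add_square_le:
  assumes "square_integrable \<mu> f" "square_integrable \<mu> g"
  shows "(LINT x|\<mu>. (cmod (f x + g x))\<^sup>2)
    \<le> 2 * (LINT x|\<mu>. (cmod (f x))\<^sup>2) + 2 * (LINT x|\<mu>. (cmod (g x))\<^sup>2)"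
proof -
  have "(LINT x|\<mu>. (cmod (f x + g x))\<^sup>2) \<le> (LINT x|\<mu>. 2 * (cmod (f x))\<^sup>2 + 2 * (cmod (g x))\<^sup>2)"
    using assms square_integrable_add[OF assms]
    by (intro integral_mono) (auto simp: square_integrable_def cmod_add_square_le)
  also have "\<dots> = 2 * (LINT x|\<mu>. (cmod (f x))\<^sup>2) + 2 * (LINT x|\<mu>. (cmod (g x))\<^sup>2)"
    using assms by (auto simp: square_integrable_def)
  finally show ?thesis .
qed

lemma (in real_distribution) l2_approximable_closed:
  assumes f: "square_integrable M f"
    and approx: "\<And>\<epsilon>. \<epsilon> > 0 \<Longrightarrow>
      \<exists>g. l2_approximable M \<Lambda> g \<and> (LINT x|M. (cmod (f x - g x))\<^sup>2) < \<epsilon>"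
  shows "l2_approximable M \<Lambda> f"
  unfolding l2_approximable_def
proof (intro conjI f allI impI)
  fix \<epsilon> :: real assume "\<epsilon> > 0"
  \<comment> \<open>Two errors below \<open>\<epsilon> / 4\<close> suffice, since
    \<open>integral_cmod_add_square_le\<close> doubles each of them.\<close>
  then obtain g where g: "l2_approximable M \<Lambda> g" "(LINT x|M. (cmod (f x - g x))\<^sup>2) < \<epsilon> / 4"
    using approx[of "\<epsilon> / 4"] by auto
  then obtain S c where S: "finite S" "S \<subseteq> \<Lambda>"
      "(LINT x|M. (cmod (g x - (\<Sum>i\<in>S. c i * expo i x)))\<^sup>2) < \<epsilon> / 4"
    using \<open>\<epsilon> > 0\<close> by (auto simp: l2_approximable_def dest!: spec[of _ "\<epsilon> / 4"])
  have "square_integrable M g"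
    using g by (simp add: l2_approximable_def)
  then have "(LINT x|M. (cmod ((f x - g x) + (g x - (\<Sum>i\<in>S. c i * expo i x))))\<^sup>2) < \<epsilon>"
    using integral_cmod_add_square_le[of M "\<lambda>x. f x - g x" "\<lambda>x. g x - (\<Sum>i\<in>S. c i * expo i x)"]
      f g S square_integrable_sum_expo[of c S] by (force intro: square_integrable_diff)
  then show "\<exists>S c. finite S \<and> S \<subseteq> \<Lambda> \<and>
      (LINT x|M. (cmod (f x - (\<Sum>i\<in>S. c i * expo i x)))\<^sup>2) < \<epsilon>"
    using S by (intro exI[of _ S] exI[of _ c]) simp
qed

text \<open>Dominated convergence turns pointwise convergence into mean square convergence, and the
  closed span is closed.\<close>

lemma (in real_distribution) l2_approximable_limit:
  assumes g: "\<And>n. l2_approximable M \<Lambda> (g n)"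
    and f: "f \<in> borel_measurable M"
    and lim: "AE x in M. (\<lambda>n. g n x) \<longlonglongrightarrow> f x"
    and h: "integrable M h" "\<And>n. AE x in M. (cmod (g n x))\<^sup>2 \<le> h x"
  shows "l2_approximable M \<Lambda> f"
proof (rule l2_approximable_closed)
  have [measurable]: "g n \<in> borel_measurable M" for n
    using g by (simp add: l2_approximable_def square_integrable_def)
  note f [measurable]
  have "AE x in M. \<forall>n. (cmod (g n x))\<^sup>2 \<le> h x"
    using h(2) by (simp add: AE_all_countable)
  with lim have bound: "AE x in M. (cmod (f x))\<^sup>2 \<le> h x"
  proof eventually_elim
    case (elim x)
    then show ?case
      by (intro tendsto_upperbound[OF tendsto_power[OF tendsto_norm[OF elim(1)]]]) auto
  qed
  then show f2: "square_integrable M f"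
    unfolding square_integrable_def
    by (intro conjI Bochner_Integration.integrable_bound[OF h(1)]) auto
  have "(\<lambda>n. LINT x|M. (cmod (f x - g n x))\<^sup>2) \<longlonglongrightarrow> (LINT x|M. 0)"
  proof (rule integral_dominated_convergence[where w = "\<lambda>x. 4 * h x"])
    show "AE x in M. (\<lambda>n. (cmod (f x - g n x))\<^sup>2) \<longlonglongrightarrow> 0"
      using lim
    proof eventually_elim
      case (elim x)
      then have "(\<lambda>n. (cmod (f x - g n x))\<^sup>2) \<longlonglongrightarrow> (cmod (f x - f x))\<^sup>2"
        by (intro tendsto_intros)
      then show ?case by simp
    qed
    \<comment> \<open>The square is at most 2 |f|^2 + 2 |g n|^2, and \<open>h\<close> bounds both
      squares.\<close>
    show "AE x in M. norm ((cmod (f x - g n x))\<^sup>2) \<le> 4 * h x" for n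
      using bound h(2)[of n]
    proof eventually_elim
      case (elim x)
      then show ?case
        using cmod_add_square_le[of "f x" "- g n x"] by simp
    qed
  qed (use h in auto)
  then have lim0: "(\<lambda>n. LINT x|M. (cmod (f x - g n x))\<^sup>2) \<longlonglongrightarrow> 0" by simp
  fix \<epsilon> :: real assume "\<epsilon> > 0"
  then obtain n where "(LINT x|M. (cmod (f x - g n x))\<^sup>2) < \<epsilon>"
    using order_tendstoD(2)[OF lim0] eventually_happens'[OF sequentially_bot] by blast
  with g show "\<exists>g. l2_approximable M \<Lambda> g \<and> (LINT x|M. (cmod (f x - g x))\<^sup>2) < \<epsilon>" by blast
qed

lemma (in real_distribution) l2_approximable_cmult:
  assumes "l2_approximable M \<Lambda> f"
  shows "l2_approximable M \<Lambda> (\<lambda>x. a * f x)"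
  unfolding l2_approximable_def
proof (intro conjI allI impI)
  show "square_integrable M (\<lambda>x. a * f x)"
    using assms by (simp add: l2_approximable_def square_integrable_cmult)
  fix \<epsilon> :: real assume "\<epsilon> > 0"
  \<comment> \<open>The summand 1 keeps the denominator positive when \<open>a = 0\<close>.\<close>
  then have "\<epsilon> / ((cmod a)\<^sup>2 + 1) > 0"
    by (intro divide_pos_pos) (auto intro: add_nonneg_pos)
  then obtain S c where S: "finite S" "S \<subseteq> \<Lambda>"
      "(LINT x|M. (cmod (f x - (\<Sum>i\<in>S. c i * expo i x)))\<^sup>2) < \<epsilon> / ((cmod a)\<^sup>2 + 1)"
    using assms unfolding l2_approximable_def by meson
  have "(LINT x|M. (cmod (a * f x - (\<Sum>i\<in>S. (a * c i) * expo i x)))\<^sup>2)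
      = (LINT x|M. (cmod a)\<^sup>2 * (cmod (f x - (\<Sum>i\<in>S. c i * expo i x)))\<^sup>2)"
    unfolding power_mult_distrib [symmetric] norm_mult [symmetric]
    by (simp only: right_diff_distrib sum_distrib_left mult.assoc)
  also have "\<dots> \<le> ((cmod a)\<^sup>2 + 1) * (LINT x|M. (cmod (f x - (\<Sum>i\<in>S. c i * expo i x)))\<^sup>2)"
    by (simp add: mult_right_mono)
  also have "\<dots> < \<epsilon>"
    using S(3) by (simp add: pos_less_divide_eq add_nonneg_pos mult.commute)
  finally show "\<exists>S c. finite S \<and> S \<subseteq> \<Lambda> \<and>
      (LINT x|M. (cmod (a * f x - (\<Sum>i\<in>S. c i * expo i x)))\<^sup>2) < \<epsilon>"
    using S(1,2) by (intro exI[of _ S] exI[of _ "\<lambda>i. a * c i"] conjI)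
qed

lemma (in real_distribution) l2_approximable_add:
  assumes f: "l2_approximable M \<Lambda> f" and g: "l2_approximable M \<Lambda> g"
  shows "l2_approximable M \<Lambda> (\<lambda>x. f x + g x)"
  unfolding l2_approximable_def
proof (intro conjI allI impI)
  have sq: "square_integrable M f" "square_integrable M g"
    using f g by (auto simp: l2_approximable_def)
  then show "square_integrable M (\<lambda>x. f x + g x)"
    by (rule square_integrable_add)
  fix \<epsilon> :: real assume "\<epsilon> > 0"
  then have "\<epsilon> / 4 > 0" by simp
  obtain S c where S: "finite S" "S \<subseteq> \<Lambda>"
      "(LINT x|M. (cmod (f x - (\<Sum>i\<in>S. c i * expo i x)))\<^sup>2) < \<epsilon> / 4"
    using f \<open>\<epsilon> / 4 > 0\<close> unfolding l2_approximable_def by meson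
  obtain T d where T: "finite T" "T \<subseteq> \<Lambda>"
      "(LINT x|M. (cmod (g x - (\<Sum>i\<in>T. d i * expo i x)))\<^sup>2) < \<epsilon> / 4"
    using g \<open>\<epsilon> / 4 > 0\<close> unfolding l2_approximable_def by meson
  \<comment> \<open>\<open>S\<close> and \<open>T\<close> may overlap, so both coefficient families
    are extended by 0 and added.\<close>
  define e where "e i = (if i \<in> S then c i else 0) + (if i \<in> T then d i else 0)" for i
  have "(\<Sum>i\<in>S \<union> T. e i * expo i x) = (\<Sum>i\<in>S. c i * expo i x) + (\<Sum>i\<in>T. d i * expo i x)" for x
  proof -
    have "(\<Sum>i\<in>S \<union> T. e i * expo i x) = (\<Sum>i\<in>S \<union> T. if i \<in> S then c i * expo i x else 0)
        + (\<Sum>i\<in>S \<union> T. if i \<in> T then d i * expo i x else 0)"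
      by (auto simp: e_def distrib_right simp flip: sum.distrib intro!: sum.cong)
    also have "(\<Sum>i\<in>S \<union> T. if i \<in> S then c i * expo i x else 0) = (\<Sum>i\<in>S. c i * expo i x)"
      using S(1) T(1) by (intro sum.mono_neutral_cong_right) auto
    also have "(\<Sum>i\<in>S \<union> T. if i \<in> T then d i * expo i x else 0) = (\<Sum>i\<in>T. d i * expo i x)"
      using S(1) T(1) by (intro sum.mono_neutral_cong_right) auto
    finally show ?thesis .
  qed
  then have "(LINT x|M. (cmod (f x + g x - (\<Sum>i\<in>S \<union> T. e i * expo i x)))\<^sup>2) =
     (LINT x|M. (cmod ((f x - (\<Sum>i\<in>S. c i * expo i x)) + (g x - (\<Sum>i\<in>T. d i * expo i x))))\<^sup>2)"
    by (simp add: algebra_simps)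
  also have "\<dots> < \<epsilon>"
    using integral_cmod_add_square_le[OF square_integrable_diff[OF sq(1) square_integrable_sum_expo]
      square_integrable_diff[OF sq(2) square_integrable_sum_expo], of c S d T] S(3) T(3)
    by linarith
  finally show "\<exists>S c. finite S \<and> S \<subseteq> \<Lambda> \<and>
      (LINT x|M. (cmod (f x + g x - (\<Sum>i\<in>S. c i * expo i x)))\<^sup>2) < \<epsilon>"
    using S T by (intro exI[of _ "S \<union> T"] exI[of _ e]) auto
qed

lemma (in real_distribution) l2_approximable_0: "l2_approximable M \<Lambda> (\<lambda>x. 0)"
  unfolding l2_approximable_def
  by (auto intro!: exI[of _ "{}"] simp: square_integrable_def)

lemma (in real_distribution) l2_approximable_sum:
  "(\<And>i. i \<in> S \<Longrightarrow> l2_approximable M \<Lambda> (f i)) \<Longrightarrow> l2_approximable M \<Lambda> (\<lambda>x. \<Sum>i\<in>S. f i x)"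
  by (induction S rule: infinite_finite_induct)
    (simp_all add: l2_approximable_0 l2_approximable_add)

section \<open>Density of the trigonometric polynomials with arbitrary real frequencies\<close>

inductive trig_poly :: "(real \<Rightarrow> complex) \<Rightarrow> bool" where
  expo: "trig_poly (\<lambda>x. c * expo t x)"
| add: "trig_poly f \<Longrightarrow> trig_poly g \<Longrightarrow> trig_poly (\<lambda>x. f x + g x)"

lemma trig_poly_mult:
  assumes "trig_poly f" "trig_poly g"
  shows "trig_poly (\<lambda>x. f x * g x)"
  using assms
proof (induction f)
  case (expo c t)
  from expo show ?case
  proof (induction g)
    case (expo d s)
    have "(\<lambda>x. c * expo t x * (d * expo s x)) = (\<lambda>x. (c * d) * expo (t + s) x)"
      by (simp add: expo_add mult_ac)
    then show ?case by (metis trig_poly.expo)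
  next
    case (add f g)
    then show ?case by (simp add: distrib_left trig_poly.add)
  qed
next
  case (add f h)
  then show ?case by (simp add: distrib_right trig_poly.add)
qed

lemma trig_poly_continuous: "trig_poly f \<Longrightarrow> continuous_on A f"
  by (induction rule: trig_poly.induct) (auto intro!: continuous_intros)

text \<open>Stone-Weierstrass is applied to the real functions whose complexification is a
  trigonometric polynomial. Since arbitrary frequencies are allowed, \<open>cos\<close> is one of
  them, and it alone separates the points of \<open>{0..2}\<close>, an interval contained in
  \<open>{0..pi}\<close>.\<close>

lemma trig_poly_uniform_approx:
  fixes f :: "real \<Rightarrow> real"
  assumes "continuous_on {0..2} f" "e > 0"
  obtains g where "trig_poly g" "\<And>x. x \<in> {0..2} \<Longrightarrow> cmod (complex_of_real (f x) - g x) < e"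
proof -
  let ?P = "\<lambda>g :: real \<Rightarrow> real. trig_poly (\<lambda>x. complex_of_real (g x))"
  have "trig_poly (\<lambda>x. (1/2) * expo (1 / (2 * pi)) x + (1/2) * expo (- (1 / (2 * pi))) x)"
    by (intro trig_poly.intros)
  then have cos: "?P cos"
    by (rule back_subst[of trig_poly]) (auto simp: expo_eq_cis complex_eq_iff)
  have "\<exists>g. ?P g \<and> (\<forall>x\<in>{0..2}. \<bar>f x - g x\<bar> < e)"
  proof (rule Stone_Weierstrass_HOL[OF compact_Icc _ _ _ _ _ assms])
    show "?P (\<lambda>x. c)" for c
      using trig_poly.expo[of "complex_of_real c" 0] by simp
    show "continuous_on {0..2} g" if "?P g" for g
      using continuous_on_Re[OF trig_poly_continuous[OF that]] by simp
    show "?P (\<lambda>x. g x + h x)" if "?P g \<and> ?P h" for g h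
      using that by (simp add: trig_poly.add)
    show "?P (\<lambda>x. g x * h x)" if "?P g \<and> ?P h" for g h
      using that by (simp add: trig_poly_mult)
    show "\<exists>f. ?P f \<and> f x \<noteq> f y" if "x \<in> {0..2} \<and> y \<in> {0..2} \<and> x \<noteq> y" for x y
    proof -
      have "x \<le> pi" "y \<le> pi" "0 \<le> x" "0 \<le> y"
        using that pi_gt3 by auto
      then have "cos x \<noteq> cos y"
        using cos_inj_pi[of x y] that by blast
      then show ?thesis
        using cos by blast
    qed
  qed
  then obtain g where g: "?P g" "\<forall>x\<in>{0..2}. \<bar>f x - g x\<bar> < e"
    by blast
  show thesis
  proof (rule that[OF g(1)])
    fix x :: real assume "x \<in> {0..2}"
    then show "cmod (complex_of_real (f x) - complex_of_real (g x)) < e"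
      using g(2) unfolding of_real_diff [symmetric] norm_of_real by blast
  qed
qed

text \<open>The closed span is enlarged in stages: trigonometric polynomials, continuous functions,
  indicators of rays, indicators of Borel sets, simple functions, and finally all of L^2.\<close>

theorem (in real_distribution) l2_approximable_if_expo:
  assumes supp: "AE x in M. x \<in> {0..2}"
    and expo: "\<And>t. l2_approximable M \<Lambda> (expo t)"
    and f: "square_integrable M f"
  shows "l2_approximable M \<Lambda> f"
proof -
  have trig: "l2_approximable M \<Lambda> g" if "trig_poly g" for g
    using that by induction (auto intro: l2_approximable_cmult l2_approximable_add expo)
  have cont: "l2_approximable M \<Lambda> (\<lambda>x. complex_of_real (g x))"
    if g: "continuous_on UNIV g" for g :: "real \<Rightarrow> real"
  proof (rule l2_approximable_closed)
    have g': "continuous_on {0..2} g"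
      using g continuous_on_subset by blast
    have gm [measurable]: "g \<in> borel_measurable borel"
      using g by (rule borel_measurable_continuous_onI)
    have "bounded (g ` {0..2})"
      by (intro compact_imp_bounded compact_continuous_image g' compact_Icc)
    then obtain K where K: "\<bar>g x\<bar> \<le> K" if "x \<in> {0..2}" for x
      unfolding bounded_iff real_norm_def by blast
    show "square_integrable M (\<lambda>x. complex_of_real (g x))"
      using supp K by (intro square_integrable_bounded[where K = K]) auto
    fix \<epsilon> :: real assume "\<epsilon> > 0"
    then obtain h where h: "trig_poly h"
        "\<And>x. x \<in> {0..2} \<Longrightarrow> cmod (complex_of_real (g x) - h x) < sqrt (\<epsilon> / 2)"
      using trig_poly_uniform_approx[OF g', of "sqrt (\<epsilon> / 2)"] by auto
    have [measurable]: "h \<in> borel_measurable borel"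
      using trig_poly_continuous[OF h(1)] by (rule borel_measurable_continuous_onI)
    have le: "(cmod (complex_of_real (g x) - h x))\<^sup>2 \<le> \<epsilon> / 2" if "x \<in> {0..2}" for x
      using power_mono[OF less_imp_le[OF h(2)[OF that]], of 2] \<open>\<epsilon> > 0\<close> by simp
    have "(LINT x|M. (cmod (complex_of_real (g x) - h x))\<^sup>2) \<le> (LINT x|M. \<epsilon> / 2)"
    proof (rule integral_mono_AE)
      show "integrable M (\<lambda>x. (cmod (complex_of_real (g x) - h x))\<^sup>2)"
        using supp le by (intro integrable_const_bound[where B = "\<epsilon> / 2"]) auto
    qed (use supp le in auto)
    then have "(LINT x|M. (cmod (complex_of_real (g x) - h x))\<^sup>2) < \<epsilon>"
      using \<open>\<epsilon> > 0\<close> prob_space by simp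
    with trig[OF h(1)] show "\<exists>h. l2_approximable M \<Lambda> h \<and>
        (LINT x|M. (cmod (complex_of_real (g x) - h x))\<^sup>2) < \<epsilon>" by blast
  qed
  \<comment> \<open>Continuous ramps that fall from 1 at \<open>a\<close> to 0 at
    \<open>a + inverse (Suc n)\<close> converge pointwise to the indicator of the ray.\<close>
  have ray: "l2_approximable M \<Lambda> (indicator {..a})" for a
  proof (rule l2_approximable_limit)
    show "l2_approximable M \<Lambda> (\<lambda>x. complex_of_real (cts_step a (a + inverse (Suc n)) x))" for n
      by (intro cont uniformly_continuous_imp_continuous cts_step_uniformly_continuous) simp
    show "AE x in M. (\<lambda>n. complex_of_real (cts_step a (a + inverse (Suc n)) x))
        \<longlonglongrightarrow> indicator {..a} x"
    proof (rule AE_I2)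
      fix x
      have "\<forall>\<^sub>F n in sequentially. cts_step a (a + inverse (Suc n)) x = indicator {..a} x"
      proof (cases "x \<le> a")
        case False
        then have "\<forall>\<^sub>F n in sequentially. inverse (Suc n) < x - a"
          using LIMSEQ_inverse_real_of_nat by (intro order_tendstoD) auto
        then show ?thesis
          by eventually_elim (use False in \<open>auto simp: cts_step_def\<close>)
      qed (auto simp: cts_step_def)
      then show "(\<lambda>n. complex_of_real (cts_step a (a + inverse (Suc n)) x))
          \<longlonglongrightarrow> indicator {..a} x"
        by (intro tendsto_eventually)
          (auto elim!: eventually_mono simp: indicator_def)
    qed
    show "AE x in M. (cmod (complex_of_real (cts_step a (a + inverse (Suc n)) x)))\<^sup>2 \<le> 1" for n
    proof (rule AE_I2)
      fix x
      have "\<bar>cts_step a b x\<bar> \<le> 1" if "a < b" for b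
        using that by (auto simp: cts_step_def abs_le_iff divide_le_eq le_divide_eq)
      from this[of "a + inverse (Suc n)"]
      have "\<bar>cts_step a (a + inverse (Suc n)) x\<bar> \<le> 1"
        by simp
      then show "(cmod (complex_of_real (cts_step a (a + inverse (Suc n)) x)))\<^sup>2 \<le> 1"
        by (simp add: abs_square_le_1)
    qed
  qed auto
  \<comment> \<open>The rays are an intersection-stable generator, so induction over the Dynkin
    system needs only complements and disjoint unions, both of which are compatible with linear
    combinations and bounded limits.\<close>
  have borel: "l2_approximable M \<Lambda> (indicator A)" if "A \<in> sets borel" for A
  proof -
    have sets_eq: "sets borel = sigma_sets UNIV (range (\<lambda>a::real. {..a}))"
      by (simp add: borel_eq_atMost)
    have "Int_stable (range (\<lambda>a::real. {..a}))"
      by (auto simp: Int_stable_def)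
    moreover have "range (\<lambda>a::real. {..a}) \<subseteq> Pow UNIV"
      by simp
    moreover have "A \<in> sigma_sets UNIV (range (\<lambda>a::real. {..a}))"
      using that sets_eq by blast
    ultimately show ?thesis
    proof (induction rule: sigma_sets_induct_disjoint)
      case (basic A)
      then show ?case using ray by auto
    next
      case empty
      then show ?case using l2_approximable_0 by (simp add: indicator_def)
    next
      case (compl A)
      have "indicator (UNIV - A) = (\<lambda>x. expo 0 x + (-1) * indicator A x :: complex)"
        by (auto simp: indicator_def fun_eq_iff)
      moreover have "l2_approximable M \<Lambda> (\<lambda>x. expo 0 x + (-1) * indicator A x)"
        using compl by (intro l2_approximable_add expo l2_approximable_cmult)
      ultimately show ?case
        by (simp only:)
    next
      case (union A)
      have [measurable]: "A i \<in> sets borel" for i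
        using union(2) sets_eq by blast
      show ?case
      proof (rule l2_approximable_limit)
        show "l2_approximable M \<Lambda> (\<lambda>x. \<Sum>i<n. indicator (A i) x)" for n
          using union by (intro l2_approximable_sum) auto
        have sum_eq: "(\<Sum>i<n. indicator (A i) x :: complex) = indicator (\<Union>i<n. A i) x" for n x
          by (rule indicator_UN_disjoint [symmetric])
            (use union(1) in \<open>auto simp: disjoint_family_on_def\<close>)
        show "AE x in M. (\<lambda>n. \<Sum>i<n. indicator (A i) x) \<longlonglongrightarrow> (indicator (\<Union>i. A i) x :: complex)"
          using LIMSEQ_indicator_UN[of A] by (auto simp: sum_eq)
        show "AE x in M. (cmod (\<Sum>i<n. indicator (A i) x))\<^sup>2 \<le> 1" for n
          unfolding sum_eq by (auto simp: indicator_def)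
        show "indicator (\<Union>i. A i) \<in> borel_measurable M"
          by measurable
        show "integrable M (\<lambda>x. 1 :: real)"
          by simp
      qed
    qed
  qed
  have fm: "f \<in> borel_measurable M" and f2: "integrable M (\<lambda>x. (cmod (f x))\<^sup>2)"
    using f by (auto simp: square_integrable_def)
  \<comment> \<open>The simple functions converge pointwise and are bounded by 2 |f|, so 4 |f|^2
    dominates their squares.\<close>
  obtain F where F: "\<And>i. simple_function M (F i)" "\<And>x. (\<lambda>i. F i x) \<longlonglongrightarrow> f x"
      "\<And>i x. dist (F i x) 0 \<le> 2 * dist (f x) 0"
    using borel_measurable_implies_sequence_metric[OF fm, of 0] by auto
  show ?thesis
  proof (rule l2_approximable_limit[where g = F and h = "\<lambda>x. 4 * (cmod (f x))\<^sup>2"])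
    fix i
    have fin: "finite (range (F i))"
      using simple_functionD(1)[OF F(1)[of i]] by simp
    have eq: "F i = (\<lambda>x. \<Sum>y\<in>range (F i). y * indicator (F i -` {y}) x)"
    proof
      fix x
      have "(\<Sum>y\<in>range (F i). y * indicator (F i -` {y}) x) = (\<Sum>y\<in>{F i x}. y)"
        using fin by (intro sum.mono_neutral_cong_right) (auto simp: indicator_def)
      then show "F i x = (\<Sum>y\<in>range (F i). y * indicator (F i -` {y}) x)" by simp
    qed
    have "F i -` {y} \<in> sets borel" for y
      using simple_functionD(2)[OF F(1)[of i], of "{y}"] by simp
    then show "l2_approximable M \<Lambda> (F i)"
      by (subst eq) (intro l2_approximable_sum l2_approximable_cmult borel)
    have "(cmod (F i x))\<^sup>2 \<le> 4 * (cmod (f x))\<^sup>2" for x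
      using power_mono[OF F(3)[of i x], of 2] by (simp add: power_mult_distrib)
    then show "AE x in M. (cmod (F i x))\<^sup>2 \<le> 4 * (cmod (f x))\<^sup>2" by simp
  qed (use F(2) fm f2 in auto)
qed

section \<open>Convolutions\<close>

lemma real_distribution_convolution:
  assumes "real_distribution M" "real_distribution N"
  shows "real_distribution (convolution M N)"
proof -
  interpret M: real_distribution M by fact
  interpret N: real_distribution N by fact
  interpret pair_prob_space M N ..
  have "prob_space (convolution M N)"
    unfolding convolution_def by (rule P.prob_space_distr) simp
  then show ?thesis
    by (auto simp: real_distribution_def real_distribution_axioms_def)
qed

lemma char_convolution:
  assumes "real_distribution M" "real_distribution N"
  shows "char (convolution M N) t = char M t * char N t"
proof -
  interpret M: real_distribution M by fact
  interpret N: real_distribution N by fact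
  interpret pair_prob_space M N ..
  have int: "integrable (M \<Otimes>\<^sub>M N) (\<lambda>(x, y). iexp (t * (x + y)))"
    by (rule P.integrable_const_bound[where B = 1]) auto
  have "char (convolution M N) t = integral\<^sup>L (M \<Otimes>\<^sub>M N) (\<lambda>z. iexp (t * (fst z + snd z)))"
    unfolding char_def convolution_def by (subst integral_distr) (auto simp: split_beta)
  also have "\<dots> = (LINT x|M. LINT y|N. iexp (t * (x + y)))"
    using integral_fst'[OF int] by (simp add: case_prod_unfold)
  also have "\<dots> = (LINT x|M. iexp (t * x) * (LINT y|N. iexp (t * y)))"
    by (simp add: distrib_left exp_add)
  also have "\<dots> = char M t * char N t"
    by (simp add: char_def)
  finally show ?thesis .
qed

lemma AE_convolution_Icc:
  assumes "real_distribution M" "real_distribution N"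
    and "AE x in M. x \<in> {0..a}" "AE y in N. y \<in> {0..b}"
  shows "AE x in convolution M N. x \<in> {0..a + b}"
proof -
  interpret M: real_distribution M by fact
  interpret N: real_distribution N by fact
  interpret pair_prob_space M N ..
  have "AE x in M. AE y in N. x + y \<in> {0..a + b}"
    using assms(3)
  proof eventually_elim
    case (elim x)
    show ?case
      using assms(4) by eventually_elim (use elim in auto)
  qed
  moreover have "{z \<in> space (M \<Otimes>\<^sub>M N). fst z + snd z \<in> {0..a + b}} \<in> sets (M \<Otimes>\<^sub>M N)"
    by measurable
  ultimately have "AE z in M \<Otimes>\<^sub>M N. fst z + snd z \<in> {0..a + b}"
    by (intro AE_pair_measure) simp_all
  then show ?thesis
    unfolding convolution_def by (subst AE_distr_iff) (auto simp: split_beta)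
qed

lemma real_distribution_unif_measure: "real_distribution (unif_measure A)"
proof -
  have "prob_space (unif_measure A)"
    unfolding unif_measure_def by (rule measure_pmf.prob_space_distr) simp
  then show ?thesis
    by (auto simp: real_distribution_def real_distribution_axioms_def unif_measure_def)
qed

lemma AE_unif_measure:
  assumes "finite A" "A \<noteq> {}" "A \<subseteq> X" "X \<in> sets borel"
  shows "AE x in unif_measure A. x \<in> X"
proof -
  have "AE x in measure_pmf (pmf_of_set A). x \<in> X"
    using assms by (auto simp: AE_measure_pmf_iff)
  then show ?thesis
    unfolding unif_measure_def using assms(4) by (subst AE_distr_iff) simp_all
qed

lemma char_unif_measure:
  assumes "finite A" "A \<noteq> {}"
  shows "char (unif_measure A) t = (\<Sum>a\<in>A. iexp (t * a)) / of_nat (card A)"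
proof -
  have "char (unif_measure A) t = (LINT x|measure_pmf (pmf_of_set A). iexp (t * x))"
    unfolding char_def unif_measure_def by (subst integral_distr) auto
  also have "\<dots> = (\<Sum>a\<in>A. iexp (t * a)) / of_nat (card A)"
    using assms by (subst integral_measure_pmf[of A])
      (auto simp: scaleR_conv_of_real sum_distrib_left divide_inverse mult.commute)
  finally show ?thesis .
qed

section \<open>Finite and infinite convolutions of measures with small supports\<close>

lemma char_fin_convolution:
  assumes "\<And>k. k \<ge> 1 \<Longrightarrow> real_distribution (\<xi> k)"
  shows "real_distribution (fin_convolution \<xi> n)"
    and "char (fin_convolution \<xi> n) t = (\<Prod>k=1..n. char (\<xi> k) t)"
proof -
  have "real_distribution (fin_convolution \<xi> n) \<and>
      char (fin_convolution \<xi> n) t = (\<Prod>k=1..n. char (\<xi> k) t)"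
  proof (induction n)
    case 0
    have "real_distribution (return borel (0 :: real))"
      by (auto simp: real_distribution_def real_distribution_axioms_def prob_space_return)
    moreover have "char (return borel 0) t = 1"
      unfolding char_def by (subst integral_return) auto
    ultimately show ?case by simp
  next
    case (Suc n)
    then show ?case
      using assms[of "Suc n"] by (simp add: real_distribution_convolution char_convolution)
  qed
  then show "real_distribution (fin_convolution \<xi> n)"
    and "char (fin_convolution \<xi> n) t = (\<Prod>k=1..n. char (\<xi> k) t)" by auto
qed

lemma AE_fin_convolution_Icc:
  assumes "\<And>k. k \<ge> 1 \<Longrightarrow> real_distribution (\<xi> k)"
    and "\<And>k. k \<ge> 1 \<Longrightarrow> AE x in \<xi> k. x \<in> {0..c k}"
  shows "AE x in fin_convolution \<xi> n. x \<in> {0..(\<Sum>k=1..n. c k)}"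
proof (induction n)
  case 0
  have "AE x in return borel (0 :: real). x \<in> {0..0}"
    by (subst AE_return) auto
  then show ?case by (simp only: fin_convolution.simps) simp
next
  case (Suc n)
  have "AE x in convolution (fin_convolution \<xi> n) (\<xi> (Suc n)). x \<in> {0..(\<Sum>k=1..n. c k) + c (Suc n)}"
    using Suc assms by (intro AE_convolution_Icc char_fin_convolution) auto
  then show ?case by (simp only: fin_convolution.simps) simp
qed

text \<open>Integrate |e^{is} - 1| <= |s|. With summable lengths \<open>c\<close> this makes the
  infinite product of the characteristic functions converge.\<close>

lemma (in real_distribution) cmod_char_minus_1_le:
  assumes "AE x in M. x \<in> {0..c}"
  shows "cmod (char M t - 1) \<le> \<bar>t\<bar> * c"
proof -
  have int: "integrable M (\<lambda>x. iexp (t * x) - 1)"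
    by (intro integrable_const_bound[where B = 2])
      (auto intro!: AE_I2 order_trans[OF norm_triangle_ineq4])
  have "char M t - 1 = (LINT x|M. iexp (t * x) - 1)"
    using prob_space unfolding char_def
    by (subst Bochner_Integration.integral_diff) (auto intro: integrable_iexp)
  also have "cmod \<dots> \<le> (LINT x|M. cmod (iexp (t * x) - 1))"
    by (rule integral_norm_bound)
  also have "\<dots> \<le> (LINT x|M. \<bar>t\<bar> * c)"
  proof (rule integral_mono_AE)
    show "AE x in M. cmod (iexp (t * x) - 1) \<le> \<bar>t\<bar> * c"
      using assms
    proof eventually_elim
      case (elim x)
      then have "\<bar>t * x\<bar> \<le> \<bar>t\<bar> * c"
        by (simp add: abs_mult mult_left_mono)
      then show ?case
        using iexp_approx1[of "t * x" 0] by simp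
    qed
  qed (use int in auto)
  also have "\<dots> = \<bar>t\<bar> * c"
    using prob_space by simp
  finally show ?thesis .
qed

text \<open>The increments of the partial products are bounded by \<open>cmod (z k - 1)\<close>,
  because the earlier factors have modulus at most 1. So the telescoping series converges
  absolutely; the limit of the product may be 0.\<close>

lemma convergent_prod_partial:
  fixes z :: "nat \<Rightarrow> complex"
  assumes "\<And>k. cmod (z k) \<le> 1" "summable (\<lambda>k. cmod (z k - 1))"
  shows "convergent (\<lambda>n. \<Prod>k=1..n. z k)"
proof -
  define p where "p n = (\<Prod>k=1..n. z k)" for n
  have le: "cmod (p (Suc n) - p n) \<le> cmod (z (Suc n) - 1)" for n
  proof -
    have "p (Suc n) - p n = p n * (z (Suc n) - 1)"
      by (simp add: p_def algebra_simps)
    moreover have "cmod (p n) \<le> 1"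
      unfolding p_def prod_norm [symmetric] using assms(1) by (intro prod_le_1) auto
    ultimately show ?thesis
      by (simp add: norm_mult mult_left_le_one_le)
  qed
  have "summable (\<lambda>n. cmod (z (Suc n) - 1))"
    using assms(2) by (subst summable_Suc_iff)
  then have "summable (\<lambda>n. p (Suc n) - p n)"
    by (rule summable_comparison_test'[where N = 0]) (rule le)
  then have "(\<lambda>n. \<Sum>k<n. p (Suc k) - p k) \<longlonglongrightarrow> (\<Sum>n. p (Suc n) - p n)"
    by (rule summable_LIMSEQ)
  then have "(\<lambda>n. p n - p 0) \<longlonglongrightarrow> (\<Sum>n. p (Suc n) - p n)"
    by (simp add: sum_lessThan_telescope)
  from tendsto_add[OF this tendsto_const[of "p 0"]] show ?thesis
    unfolding convergent_def p_def by auto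
qed

text \<open>This justifies the description in the definition of \<open>inf_convolution\<close>. The
  common bounded support gives tightness, hence a weak limit \<open>\<mu>\<close> along a
  subsequence. The characteristic functions converge along the whole sequence, so their limit is
  that of \<open>\<mu>\<close>, and the continuity and uniqueness theorems of Levy give weak
  convergence of the whole sequence to a unique limit.\<close>

theorem inf_convolution:
  assumes dist: "\<And>k. k \<ge> 1 \<Longrightarrow> real_distribution (\<xi> k)"
    and supp: "\<And>k. k \<ge> 1 \<Longrightarrow> AE x in \<xi> k. x \<in> {0..c k}"
    and sum_le: "\<And>n. (\<Sum>k=1..n. c k) \<le> K" and c: "summable c"
  shows "real_distribution (inf_convolution \<xi>)"
    and "(\<lambda>n. \<Prod>k=1..n. char (\<xi> k) t) \<longlonglongrightarrow> char (inf_convolution \<xi>) t"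
    and "AE x in inf_convolution \<xi>. x \<in> {0..K}"
proof -
  let ?F = "fin_convolution \<xi>"
  have F: "real_distribution (?F n)" "char (?F n) t = (\<Prod>k=1..n. char (\<xi> k) t)" for n t
    using dist by (simp_all only: char_fin_convolution)
  have K: "AE x in ?F n. x \<in> {0..K}" for n
  proof -
    have "AE x in ?F n. x \<in> {0..(\<Sum>k=1..n. c k)}"
      by (rule AE_fin_convolution_Icc) (use dist supp in auto)
    then show ?thesis
      by eventually_elim (use sum_le[of n] in auto)
  qed
  have "tight ?F"
    unfolding tight_def
  proof (intro conjI allI impI F)
    fix \<epsilon> :: real assume "\<epsilon> > 0"
    \<comment> \<open>The interval is open on the left, hence the endpoint -1; the maximum makes it
      nonempty whatever the sign of \<open>K\<close>.\<close>
    have "measure (?F n) {-1<..max K 0} = 1" for n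
    proof -
      interpret real_distribution "?F n" by (rule F)
      have "AE x in ?F n. x \<in> {-1<..max K 0}"
        using K[of n] by eventually_elim auto
      then show ?thesis
        by (subst prob_eq_1) auto
    qed
    with \<open>\<epsilon> > 0\<close> show "\<exists>a b. a < b \<and> (\<forall>n. 1 - \<epsilon> < measure (?F n) {a<..b})"
      by (intro exI[of _ "-1"] exI[of _ "max K 0"]) auto
  qed
  from tight_imp_convergent_subsubsequence[OF this strict_mono_id]
  obtain r \<mu> where r: "strict_mono r" and \<mu>: "real_distribution \<mu>" "weak_conv_m (?F \<circ> r) \<mu>"
    by auto
  have conv: "(\<lambda>n. char (?F n) t) \<longlonglongrightarrow> char \<mu> t" for t
  proof -
    \<comment> \<open>Nothing is assumed about \<open>\<xi> 0\<close>, so the factor at index 0 is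
      replaced by 1.\<close>
    let ?z = "\<lambda>k. if k = 0 then 1 else char (\<xi> k) t"
    have "convergent (\<lambda>n. \<Prod>k=1..n. ?z k)"
    proof (rule convergent_prod_partial)
      show "cmod (?z k) \<le> 1" for k
        using dist[of k] by (auto intro: real_distribution.cmod_char_le_1)
      have "cmod (?z k - 1) \<le> \<bar>t\<bar> * c k" if "k \<ge> 1" for k
        using real_distribution.cmod_char_minus_1_le[OF dist[OF that] supp[OF that]] that by auto
      then show "summable (\<lambda>k. cmod (?z k - 1))"
        by (intro summable_comparison_test'[OF summable_mult[OF c], where N = 1]) simp
    qed
    also have "(\<lambda>n. \<Prod>k=1..n. ?z k) = (\<lambda>n. char (?F n) t)"
      unfolding F(2) by (intro ext prod.cong) auto
    finally obtain l where l: "(\<lambda>n. char (?F n) t) \<longlonglongrightarrow> l"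
      by (auto simp: convergent_def)
    have "(\<lambda>n. char ((?F \<circ> r) n) t) \<longlonglongrightarrow> char \<mu> t"
      by (rule levy_continuity1[OF _ \<mu>]) (simp add: F)
    moreover have "(\<lambda>n. char ((?F \<circ> r) n) t) \<longlonglongrightarrow> l"
      using LIMSEQ_subseq_LIMSEQ[OF l r] by (simp add: o_def)
    ultimately show ?thesis
      using l LIMSEQ_unique by blast
  qed
  have weak: "weak_conv_m ?F \<mu>"
    by (rule levy_continuity[OF F(1) \<mu>(1) conv])
  have uniq: "\<nu> = \<mu>" if \<nu>: "real_distribution \<nu>" "weak_conv_m ?F \<nu>" for \<nu>
  proof (rule Levy_uniqueness[OF \<nu>(1) \<mu>(1)])
    show "char \<nu> = char \<mu>"
      using LIMSEQ_unique[OF levy_continuity1[OF F(1) \<nu>] conv] by blast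
  qed
  have eq: "inf_convolution \<xi> = \<mu>"
    unfolding inf_convolution_def
    by (rule the_equality) (use \<mu>(1) weak uniq in blast)+
  show "real_distribution (inf_convolution \<xi>)"
    by (simp add: eq \<mu>)
  show "(\<lambda>n. \<Prod>k=1..n. char (\<xi> k) t) \<longlonglongrightarrow> char (inf_convolution \<xi>) t"
    using conv[of t] unfolding eq F(2) .
  interpret real_distribution \<mu> by (rule \<mu>)
  \<comment> \<open>A bounded continuous function that vanishes exactly on \<open>{0..K}\<close>:
    its integral is 0 for each finite convolution, hence also for the weak limit, which confines the
    support.\<close>
  define f where "f x = min 1 (max 0 (- x) + max 0 (x - K))" for x :: real
  have f01: "0 \<le> f x" "f x \<le> 1" for x by (auto simp: f_def)
  have fcont: "continuous_on UNIV f"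
    unfolding f_def by (intro continuous_intros)
  then have fm [measurable]: "f \<in> borel_measurable borel"
    by (rule borel_measurable_continuous_onI)
  have "(\<lambda>n. integral\<^sup>L (?F n) f) \<longlonglongrightarrow> integral\<^sup>L \<mu> f"
    by (rule weak_conv_imp_integral_bdd_continuous_conv[OF F(1) \<mu>(1) weak, where B = 1])
      (use fcont f01 in \<open>auto simp: continuous_on_eq_continuous_at\<close>)
  moreover have "integral\<^sup>L (?F n) f = 0" for n
  proof (rule integral_eq_zero_AE)
    show "AE x in ?F n. f x = 0"
      using K[of n] by eventually_elim (auto simp: f_def)
  qed
  ultimately have "integral\<^sup>L \<mu> f = 0"
    using LIMSEQ_unique[OF tendsto_const] by force
  moreover have "integrable \<mu> f"
    using f01 by (intro integrable_const_bound[where B = 1]) auto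
  ultimately have "AE x in \<mu>. f x = 0"
    using integral_nonneg_eq_0_iff_AE[of \<mu> f] f01 by simp
  then show "AE x in inf_convolution \<xi>. x \<in> {0..K}"
    unfolding eq by eventually_elim (auto simp: f_def min_def max_def split: if_splits)
qed

section \<open>Mask polynomials and Hadamard triples\<close>

text \<open>This is the Fourier transform of the uniform measure on \<open>B\<close>, in the
  convention of \<open>char\<close> at the point 2 pi t, that is, with a positive sign in the
  exponent.\<close>

definition mask :: "int set \<Rightarrow> real \<Rightarrow> complex" where
  "mask B t = (\<Sum>b\<in>B. expo t (real_of_int b)) / of_nat (card B)"

lemma mask_0 [simp]: "finite B \<Longrightarrow> B \<noteq> {} \<Longrightarrow> mask B 0 = 1"
  by (simp add: mask_def)

lemma cmod_mask_le_1: "cmod (mask B t) \<le> 1"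
proof -
  have "cmod (\<Sum>b\<in>B. expo t (real_of_int b)) \<le> real (card B)"
    using norm_sum[of "\<lambda>b. expo t (real_of_int b)" B] by simp
  then show ?thesis
    by (cases "card B = 0") (simp_all add: mask_def norm_divide divide_le_eq)
qed

lemma expo_int_int [simp]: "expo (real_of_int k) (real_of_int b) = 1"
  using cis_multiple_2pi[of "real_of_int (k * b)"] by (simp add: expo_eq_cis mult.assoc)

lemma mask_periodic: "mask B (t + real_of_int k) = mask B t"
  by (simp add: mask_def expo_add)

lemma cmod_expo_diff_le: "cmod (expo s x - expo t x) \<le> 2 * pi * \<bar>s - t\<bar> * \<bar>x\<bar>"
proof -
  have "expo s x - expo t x = expo t x * (expo (s - t) x - 1)"
    using expo_add[of t "s - t" x] by (simp add: algebra_simps)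
  moreover have "cmod (expo (s - t) x - 1) \<le> \<bar>2 * pi * (s - t) * x\<bar>"
    using iexp_approx1[of "2 * pi * (s - t) * x" 0] by (simp add: expo_eq_cis cis_conv_exp)
  ultimately show ?thesis
    by (simp add: norm_mult abs_mult)
qed

lemma cmod_mask_diff_le:
  assumes "B \<subseteq> {0..K}" "B \<noteq> {}"
  shows "cmod (mask B s - mask B t) \<le> 2 * pi * K * \<bar>s - t\<bar>"
proof -
  have "finite B"
    using assms(1) by (rule finite_subset) simp
  then have card: "card B > 0"
    using assms(2) by (simp add: card_gt_0_iff)
  have "cmod (\<Sum>b\<in>B. expo s b - expo t b) \<le> (\<Sum>b\<in>B. 2 * pi * K * \<bar>s - t\<bar>)"
  proof (rule sum_norm_le)
    fix b assume "b \<in> B"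
    then have "\<bar>real_of_int b\<bar> \<le> real_of_int K"
      using assms by auto
    then have "2 * pi * \<bar>s - t\<bar> * \<bar>real_of_int b\<bar> \<le> 2 * pi * \<bar>s - t\<bar> * K"
      by (intro mult_left_mono) auto
    also have "\<dots> = 2 * pi * K * \<bar>s - t\<bar>"
      by simp
    finally show "cmod (expo s b - expo t b) \<le> 2 * pi * K * \<bar>s - t\<bar>"
      using cmod_expo_diff_le by (rule order_trans [rotated])
  qed
  then have "cmod (\<Sum>b\<in>B. expo s b - expo t b) / card B \<le> 2 * pi * K * \<bar>s - t\<bar>"
    using card by (simp add: divide_le_eq mult_ac)
  moreover have "mask B s - mask B t = (\<Sum>b\<in>B. expo s b - expo t b) / of_nat (card B)"
    by (simp add: mask_def sum_subtractf diff_divide_distrib)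
  ultimately show ?thesis
    by (simp add: norm_divide)
qed

text \<open>Expand the squared modulus as a double sum over \<open>B\<close>. Orthogonality of the
  rows of the Hadamard matrix removes the terms with two different digits, and each of the M
  diagonal terms contributes M / M^2. This is the Parseval identity of a single level.\<close>

lemma hadamard_triple_sum_mask:
  assumes "hadamard_triple N B L"
  shows "(\<Sum>l\<in>L. (cmod (mask B (t + real_of_int l / real_of_int N)))\<^sup>2) = 1"
proof -
  define M where "M = card B"
  define H where "H b l = complex_of_real (1 / sqrt (real (card B))) *
      exp (- 2 * complex_of_real pi * \<i> * of_int b * of_int l / of_int N)" for b l :: int
  have fin: "finite B" "B \<noteq> {}" "N \<ge> 2" and U: "unitary_on B L H"
    using assms unfolding hadamard_triple_def H_def [abs_def] by auto
  then have M: "M > 0"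
    by (simp add: M_def card_gt_0_iff)
  have H: "H b l = complex_of_real (1 / sqrt M) * expo (- (l / N)) b" for b l :: int
    by (simp add: H_def M_def expo_def mult_ac)
  have orth: "(\<Sum>l\<in>L. expo (l / N) b * cnj (expo (l / N) b')) = (if b = b' then of_nat M else 0)"
    if "b \<in> B" "b' \<in> B" for b b' :: int
  proof -
    \<comment> \<open>The exponents in \<open>H\<close> are negative, so \<open>b\<close> and
      \<open>b'\<close> change places.\<close>
    have "(\<Sum>l\<in>L. H b' l * cnj (H b l)) = (if b' = b then 1 else 0)"
      using U that unfolding unitary_on_def by blast
    moreover have "H b' l * cnj (H b l) = expo (l / N) b * cnj (expo (l / N) b') / of_nat M" for l
    proof -
      have "complex_of_real (1 / sqrt M) * complex_of_real (1 / sqrt M) = 1 / of_nat M"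
        unfolding of_real_mult [symmetric] by simp
      moreover have "H b' l * cnj (H b l) = (complex_of_real (1 / sqrt M) * complex_of_real (1 / sqrt M))
          * (expo (- (l / N)) b' * cnj (expo (- (l / N)) b))"
        unfolding H by (simp only: complex_cnj_mult complex_cnj_complex_of_real mult_ac)
      ultimately show ?thesis
        by (simp add: cnj_expo)
    qed
    ultimately have "(\<Sum>l\<in>L. expo (l / N) b * cnj (expo (l / N) b')) / of_nat M = (if b = b' then 1 else 0)"
      by (auto simp: sum_divide_distrib)
    then show ?thesis
      using M by (auto simp: field_simps split: if_splits)
  qed
  have square: "complex_of_real ((cmod (mask B (t + l / N)))\<^sup>2)
      = (\<Sum>b\<in>B. \<Sum>b'\<in>B. expo t b * cnj (expo t b') *
          (expo (l / N) b * cnj (expo (l / N) b'))) / (of_nat M)\<^sup>2" for l :: int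
    unfolding complex_norm_square mask_def M_def [symmetric] complex_cnj_divide cnj_sum
      times_divide_times_eq sum_product expo_add complex_cnj_mult
    by (simp add: power2_eq_square mult_ac)
  have "complex_of_real (\<Sum>l\<in>L. (cmod (mask B (t + l / N)))\<^sup>2)
      = (\<Sum>l\<in>L. \<Sum>b\<in>B. \<Sum>b'\<in>B. expo t b * cnj (expo t b') *
          (expo (l / N) b * cnj (expo (l / N) b'))) / (of_nat M)\<^sup>2"
    by (simp only: of_real_sum square sum_divide_distrib [symmetric])
  also have "(\<Sum>l\<in>L. \<Sum>b\<in>B. \<Sum>b'\<in>B. expo t b * cnj (expo t b') * (expo (l / N) b * cnj (expo (l / N) b')))
      = (\<Sum>b\<in>B. \<Sum>b'\<in>B. expo t b * cnj (expo t b') * (\<Sum>l\<in>L. expo (l / N) b * cnj (expo (l / N) b')))"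
    unfolding sum_distrib_left by (rule trans[OF sum.swap sum.cong[OF refl sum.swap]])
  also have "\<dots> = (\<Sum>b\<in>B. \<Sum>b'\<in>B. if b' = b then of_nat M * (expo t b * cnj (expo t b)) else 0)"
    by (intro sum.cong refl) (auto simp: orth)
  also have "\<dots> = (\<Sum>b\<in>B. of_nat M)"
    using fin by (simp add: complex_norm_square [symmetric])
  also have "\<dots> / (of_nat M)\<^sup>2 = 1"
    using M by (simp add: M_def [symmetric] power2_eq_square)
  finally show ?thesis
    by (metis of_real_eq_1_iff)
qed

section \<open>Fourier transforms of the Cantor-Moran measure and of its tails\<close>

locale hadamard_sequence =
  fixes N :: "nat \<Rightarrow> int" and B L :: "nat \<Rightarrow> int set"
  assumes triple: "n \<ge> 1 \<Longrightarrow> hadamard_triple (N n) (B n) (L n)"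
    and digits: "n \<ge> 1 \<Longrightarrow> B n \<subseteq> {0..N n - 1}"
begin

definition P :: "nat \<Rightarrow> int" where "P n = (\<Prod>i=1..n. N i)"

lemma N_ge_2: "n \<ge> 1 \<Longrightarrow> N n \<ge> 2"
  and B_finite: "n \<ge> 1 \<Longrightarrow> finite (B n)"
  and B_nonempty: "n \<ge> 1 \<Longrightarrow> B n \<noteq> {}"
  using triple by (auto simp: hadamard_triple_def)

lemma P_0 [simp]: "P 0 = 1" and P_Suc: "P (Suc n) = P n * N (Suc n)"
  by (simp_all add: P_def)

lemma P_pos: "P n > 0"
  using N_ge_2 by (force simp: P_def intro!: prod_pos)

lemma P_add_ge: "P (n + k) \<ge> P n * 2 ^ k"
proof (induction k)
  case (Suc k)
  have "P n * 2 ^ k * 2 \<le> P (n + k) * N (Suc (n + k))"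
    using Suc P_pos[of n] P_pos[of "n + k"] N_ge_2[of "Suc (n + k)"] by (intro mult_mono) auto
  then show ?case by (simp add: P_Suc mult_ac)
qed simp

lemma P_ge: "2 ^ n \<le> real_of_int (P n)"
proof -
  have "real_of_int (2 ^ n) \<le> real_of_int (P n)"
    unfolding of_int_le_iff using P_add_ge[of 0 n] by simp
  then show ?thesis by simp
qed

lemma P_dvd: "k \<le> n \<Longrightarrow> P k dvd P n"
  by (induction n rule: dec_induct) (auto simp: P_Suc)

definition factor :: "nat \<Rightarrow> real \<Rightarrow> complex" where
  "factor k \<xi> = mask (B k) (\<xi> / P k)"

definition partial_ft :: "nat \<Rightarrow> real \<Rightarrow> complex" where
  "partial_ft n \<xi> = (\<Prod>k=1..n. factor k \<xi>)"

text \<open>The tail is not rescaled here: the transform of the rescaled tail at \<open>y\<close> is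
  \<open>tail_ft n (P n * y)\<close>.\<close>

definition tail_ft :: "nat \<Rightarrow> real \<Rightarrow> complex" where
  "tail_ft n \<xi> = char (tail_measure N B n) (2 * pi * \<xi>)"

text \<open>A digit of level \<open>k\<close> is at most \<open>N k\<close>, so the support is
  bounded by the inverse of \<open>P (k - 1)\<close>, which is at most 2 / 2^k. The free
  \<open>n\<close> fits the bound to the tail after level \<open>n\<close>, whose k-th measure has
  index \<open>n + k\<close>.\<close>

lemma level_measure_props:
  assumes "k \<ge> 1"
  shows "real_distribution (level_measure N B k)"
    and "char (level_measure N B k) (2 * pi * \<xi>) = factor k \<xi>"
    and "AE x in level_measure N B k. x \<in> {0..2 * (1/2) ^ (k - n)}"
proof -
  let ?A = "(\<lambda>b. real_of_int b / real_of_int (P k)) ` B k"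
  have level: "level_measure N B k = unif_measure ?A"
    by (simp add: level_measure_def P_def)
  have inj: "inj_on (\<lambda>b. real_of_int b / real_of_int (P k)) (B k)"
    using P_pos[of k] by (auto simp: inj_on_def)
  have A: "finite ?A" "?A \<noteq> {}"
    using assms B_finite B_nonempty by auto
  show "real_distribution (level_measure N B k)"
    by (simp add: level real_distribution_unif_measure)
  show "char (level_measure N B k) (2 * pi * \<xi>) = factor k \<xi>"
    unfolding level char_unif_measure[OF A] sum.reindex[OF inj] card_image[OF inj]
    by (simp add: factor_def mask_def expo_eq_cis cis_conv_exp mult_ac)
  show "AE x in level_measure N B k. x \<in> {0..2 * (1/2) ^ (k - n)}"
    unfolding level
  proof (rule AE_unif_measure[OF A])
    show "?A \<subseteq> {0..2 * (1/2) ^ (k - n)}"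
    proof clarify
      fix b assume b: "b \<in> B k"
      obtain j where k: "k = Suc j"
        using assms by (cases k) auto
      have b': "0 \<le> b" "b \<le> N k"
        using digits[OF assms] b by auto
      have "real_of_int b / P k \<le> N k / P k"
        using b' P_pos[of k] by (intro divide_right_mono) auto
      also have "\<dots> = 1 / P j"
        using N_ge_2[OF assms] by (simp add: k P_Suc)
      also have "\<dots> \<le> 1 / 2 ^ j"
        using P_ge[of j] P_pos[of j] by (intro divide_left_mono) auto
      also have "\<dots> = 2 * (1/2) ^ k"
        by (simp add: k power_divide)
      also have "\<dots> \<le> 2 * (1/2) ^ (k - n)"
        by (intro mult_left_mono power_decreasing) auto
      finally show "real_of_int b / P k \<in> {0..2 * (1/2) ^ (k - n)}"
        using b' P_pos[of k] by simp
    qed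
  qed simp
qed

text \<open>The geometric bounds on the supports add up to at most 2. The interval
  \<open>{0..2}\<close> is the one for which density of the exponentials is available.\<close>

lemma tail_measure_props:
  shows "real_distribution (tail_measure N B n)"
    and "(\<lambda>m. \<Prod>k=1..m. factor (n + k) \<xi>) \<longlonglongrightarrow> tail_ft n \<xi>"
    and "AE x in tail_measure N B n. x \<in> {0..2}"
proof -
  let ?c = "\<lambda>k. 2 * (1/2) ^ k :: real"
  have geo: "(\<Sum>k=1..m. ?c k) \<le> 2" for m
  proof -
    have "(\<Sum>k=1..m. ?c k) = 2 - ?c m"
      by (induction m) auto
    then show ?thesis by simp
  qed
  have dist: "real_distribution (level_measure N B (n + k))" if "k \<ge> 1" for k
    using that by (intro level_measure_props) auto
  have supp: "AE x in level_measure N B (n + k). x \<in> {0..?c k}" if "k \<ge> 1" for k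
    using level_measure_props(3)[of "n + k" n] that by simp
  have summ: "summable ?c"
    by (intro summable_mult summable_geometric) simp
  note inf = inf_convolution[where \<xi> = "\<lambda>k. level_measure N B (n + k)" and c = ?c,
      folded tail_measure_def]
  show "real_distribution (tail_measure N B n)"
    by (rule inf(1)) (use dist supp geo summ in auto)
  show "AE x in tail_measure N B n. x \<in> {0..2}"
    by (rule inf(3)) (use dist supp geo summ in auto)
  have "(\<lambda>m. \<Prod>k=1..m. char (level_measure N B (n + k)) (2 * pi * \<xi>)) \<longlonglongrightarrow> tail_ft n \<xi>"
    unfolding tail_ft_def by (rule inf(2)) (use dist supp geo summ in auto)
  moreover have "(\<Prod>k=1..m. char (level_measure N B (n + k)) (2 * pi * \<xi>))
      = (\<Prod>k=1..m. factor (n + k) \<xi>)" for m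
    by (intro prod.cong refl level_measure_props) auto
  ultimately show "(\<lambda>m. \<Prod>k=1..m. factor (n + k) \<xi>) \<longlonglongrightarrow> tail_ft n \<xi>"
    by simp
qed

lemma tail_measure_0: "tail_measure N B 0 = cantor_moran N B"
  by (simp add: tail_measure_def cantor_moran_def)

lemma tail_ft_0 [simp]: "tail_ft n 0 = 1"
  using tail_measure_props(1) by (simp add: tail_ft_def real_distribution.char_zero)

lemma cmod_tail_ft_le_1: "cmod (tail_ft n \<xi>) \<le> 1"
  using tail_measure_props(1) by (simp add: tail_ft_def real_distribution.cmod_char_le_1)

lemma cmod_factor_le_1: "cmod (factor k \<xi>) \<le> 1"
  by (simp add: factor_def cmod_mask_le_1)

lemma tail_ft_Suc: "tail_ft n \<xi> = factor (Suc n) \<xi> * tail_ft (Suc n) \<xi>"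
proof -
  have "(\<lambda>m. factor (Suc n) \<xi> * (\<Prod>k=1..m. factor (Suc n + k) \<xi>))
      \<longlonglongrightarrow> factor (Suc n) \<xi> * tail_ft (Suc n) \<xi>"
    by (intro tendsto_mult tendsto_const tail_measure_props)
  moreover have "factor (Suc n) \<xi> * (\<Prod>k=1..m. factor (Suc n + k) \<xi>)
      = (\<Prod>k=1..Suc m. factor (n + k) \<xi>)" for m
    by (induction m) auto
  ultimately have "(\<lambda>m. \<Prod>k=1..Suc m. factor (n + k) \<xi>)
      \<longlonglongrightarrow> factor (Suc n) \<xi> * tail_ft (Suc n) \<xi>"
    by simp
  then show ?thesis
    using LIMSEQ_Suc[OF tail_measure_props(2)[of n \<xi>]] LIMSEQ_unique by blast
qed

lemma partial_ft_tail_ft: "tail_ft 0 \<xi> = partial_ft n \<xi> * tail_ft n \<xi>"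
proof (induction n)
  case (Suc n)
  then show ?case
    by (simp add: partial_ft_def tail_ft_Suc[of n])
qed (simp add: partial_ft_def)

lemma partial_ft_tendsto: "(\<lambda>n. partial_ft n \<xi>) \<longlonglongrightarrow> tail_ft 0 \<xi>"
  using tail_measure_props(2)[where n = 0] by (simp add: partial_ft_def)

text \<open>Products of factors in the unit disc differ by at most the sum of the differences of the
  factors. The factor \<open>n + k\<close> has Lipschitz constant 2 pi / P (n + k - 1), at most 4 pi
  2^(-k) / P n. In the rescaled variable the constant 4 pi does not depend on \<open>n\<close>, so
  the transforms of the rescaled tails are equicontinuous.\<close>

lemma cmod_tail_ft_diff_le: "cmod (tail_ft n \<xi> - tail_ft n \<eta>) \<le> 4 * pi * \<bar>\<xi> - \<eta>\<bar> / P n"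
proof (rule tendsto_upperbound)
  show "(\<lambda>m. cmod ((\<Prod>k=1..m. factor (n + k) \<xi>) - (\<Prod>k=1..m. factor (n + k) \<eta>)))
      \<longlonglongrightarrow> cmod (tail_ft n \<xi> - tail_ft n \<eta>)"
    by (intro tendsto_intros tail_measure_props)
  have P: "real_of_int (P i) > 0" for i
    using P_pos[of i] by simp
  have step: "cmod (factor (n + k) \<xi> - factor (n + k) \<eta>) \<le> 4 * pi * \<bar>\<xi> - \<eta>\<bar> / P n * (1/2) ^ k"
    if k: "k \<ge> 1" for k
  proof -
    obtain j where j: "k = Suc j"
      using k by (cases k) auto
    have "cmod (factor (n + k) \<xi> - factor (n + k) \<eta>) \<le> 2 * pi * N (n + k) * \<bar>\<xi> / P (n + k) - \<eta> / P (n + k)\<bar>"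
      unfolding factor_def using digits[of "n + k"] B_nonempty[of "n + k"] k
      by (intro cmod_mask_diff_le) force+
    also have "\<dots> = 2 * pi * \<bar>\<xi> - \<eta>\<bar> * (N (n + k) / P (n + k))"
      using P[of "n + k"] by (simp flip: diff_divide_distrib)
    also have "\<dots> \<le> 2 * pi * \<bar>\<xi> - \<eta>\<bar> * (1 / (P n * 2 ^ j))"
    proof (rule mult_left_mono)
      have "N (n + k) / P (n + k) = 1 / P (n + j)"
        using N_ge_2[of "n + k"] k by (simp add: j P_Suc)
      moreover have "real_of_int (P n * 2 ^ j) \<le> real_of_int (P (n + j))"
        unfolding of_int_le_iff by (rule P_add_ge)
      then have "1 / real_of_int (P (n + j)) \<le> 1 / (P n * 2 ^ j)"
        using P[of n] P[of "n + j"] by (intro divide_left_mono) auto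
      ultimately show "N (n + k) / P (n + k) \<le> 1 / (P n * 2 ^ j)"
        by simp
    qed simp
    also have "\<dots> = 4 * pi * \<bar>\<xi> - \<eta>\<bar> / P n * (1/2) ^ k"
      by (simp add: j power_divide)
    finally show ?thesis .
  qed
  have geo: "(\<Sum>k=1..m. (1/2::real) ^ k) \<le> 1" for m
  proof -
    have "(\<Sum>k=1..m. (1/2::real) ^ k) = 1 - (1/2) ^ m"
      by (induction m) auto
    then show "(\<Sum>k=1..m. (1/2::real) ^ k) \<le> 1" by simp
  qed
  show "\<forall>\<^sub>F m in sequentially. cmod ((\<Prod>k=1..m. factor (n + k) \<xi>) - (\<Prod>k=1..m. factor (n + k) \<eta>))
      \<le> 4 * pi * \<bar>\<xi> - \<eta>\<bar> / P n"
  proof (intro always_eventually allI)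
    fix m
    have "cmod ((\<Prod>k=1..m. factor (n + k) \<xi>) - (\<Prod>k=1..m. factor (n + k) \<eta>))
        \<le> (\<Sum>k=1..m. cmod (factor (n + k) \<xi> - factor (n + k) \<eta>))"
      by (intro norm_prod_diff cmod_factor_le_1)
    also have "\<dots> \<le> (\<Sum>k=1..m. 4 * pi * \<bar>\<xi> - \<eta>\<bar> / P n * (1/2) ^ k)"
      using step by (intro sum_mono) auto
    also have "\<dots> = 4 * pi * \<bar>\<xi> - \<eta>\<bar> / P n * (\<Sum>k=1..m. (1/2) ^ k)"
      by (simp add: sum_distrib_left)
    also have "\<dots> \<le> 4 * pi * \<bar>\<xi> - \<eta>\<bar> / P n"
      using geo[of m] P[of n] by (intro mult_right_le_one_le) (auto intro: sum_nonneg)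
    finally show "cmod ((\<Prod>k=1..m. factor (n + k) \<xi>) - (\<Prod>k=1..m. factor (n + k) \<eta>))
        \<le> 4 * pi * \<bar>\<xi> - \<eta>\<bar> / P n" .
  qed
qed simp

section \<open>Spectra of the finite convolutions\<close>

text \<open>The Parseval identity for every exponential: the criterion of Jorgensen and Pedersen for
  \<open>\<Lambda>\<close> to be a spectrum of the n-th finite convolution.\<close>

definition spectrum :: "nat \<Rightarrow> int set \<Rightarrow> bool" where
  "spectrum n \<Lambda> \<longleftrightarrow> finite \<Lambda> \<and> (\<forall>\<xi>. (\<Sum>\<nu>\<in>\<Lambda>. (cmod (partial_ft n (\<xi> + real_of_int \<nu>)))\<^sup>2) = 1)"

lemma factor_periodic:
  assumes "k \<le> n"
  shows "factor k (\<xi> + real_of_int (P n * j)) = factor k \<xi>"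
proof -
  obtain q where "P n = P k * q"
    using P_dvd[OF assms] by blast
  then have "(\<xi> + real_of_int (P n * j)) / P k = \<xi> / P k + real_of_int (q * j)"
    using P_pos[of k] by (simp add: field_simps)
  then show ?thesis
    by (simp only: factor_def mask_periodic)
qed

lemma partial_ft_periodic: "partial_ft n (\<xi> + real_of_int (P n * j)) = partial_ft n \<xi>"
  unfolding partial_ft_def by (intro prod.cong refl factor_periodic) auto

lemma partial_ft_0 [simp]: "partial_ft n 0 = 1"
  unfolding partial_ft_def factor_def using B_finite B_nonempty by (intro prod.neutral) auto

lemma partial_ft_multiple [simp]: "partial_ft n (real_of_int (P n * j)) = 1"
  using partial_ft_periodic[of n 0 j] by simp

text \<open>At the point \<open>- \<nu>'\<close> the term of \<open>\<nu>'\<close> alone already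
  gives the full sum 1, so every other term vanishes.\<close>

lemma spectrum_orthogonal:
  assumes "spectrum n \<Lambda>" "\<nu> \<in> \<Lambda>" "\<nu>' \<in> \<Lambda>" "\<nu> \<noteq> \<nu>'"
  shows "partial_ft n (real_of_int (\<nu> - \<nu>')) = 0"
proof -
  let ?f = "\<lambda>\<nu>. (cmod (partial_ft n (- real_of_int \<nu>' + real_of_int \<nu>)))\<^sup>2"
  have "finite \<Lambda>" "sum ?f \<Lambda> = 1"
    using assms(1) unfolding spectrum_def by blast+
  moreover have "sum ?f {\<nu>', \<nu>} \<le> sum ?f \<Lambda>"
    using assms \<open>finite \<Lambda>\<close> by (intro sum_mono2) auto
  ultimately have "?f \<nu> \<le> 0"
    using assms(4) by simp
  then show ?thesis
    by (simp add: add.commute)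
qed

text \<open>At multiples of \<open>P n\<close> the transform equals 1 and cannot vanish. Hence
  translations by such multiples never merge two frequencies.\<close>

lemma spectrum_not_congruent:
  assumes "spectrum n \<Lambda>" "\<nu> \<in> \<Lambda>" "\<nu>' \<in> \<Lambda>" "\<nu> + P n * j = \<nu>' + P n * j'"
  shows "\<nu> = \<nu>'"
proof (rule ccontr)
  assume "\<nu> \<noteq> \<nu>'"
  with assms have "partial_ft n (real_of_int (\<nu> - \<nu>')) = 0"
    by (intro spectrum_orthogonal)
  moreover have "\<nu> - \<nu>' = P n * (j' - j)"
    using assms(4) by (simp add: algebra_simps)
  ultimately show False
    by (metis partial_ft_multiple zero_neq_one)
qed

lemma spectrum_0: "spectrum 0 {0}"
  by (simp add: spectrum_def partial_ft_def)

text \<open>All factors up to level \<open>n\<close> have period \<open>P n\<close>. This is the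
  freedom that later moves frequencies to places where the tail transform is large.\<close>

lemma spectrum_shift:
  assumes "spectrum n \<Lambda>"
  shows "spectrum n ((\<lambda>\<nu>. \<nu> + P n * \<kappa> \<nu>) ` \<Lambda>)"
proof -
  have "inj_on (\<lambda>\<nu>. \<nu> + P n * \<kappa> \<nu>) \<Lambda>"
    using spectrum_not_congruent[OF assms] by (auto intro: inj_onI)
  moreover have "partial_ft n (\<xi> + real_of_int (\<nu> + P n * \<kappa> \<nu>)) = partial_ft n (\<xi> + real_of_int \<nu>)" for \<xi> \<nu>
    using partial_ft_periodic[of n "\<xi> + real_of_int \<nu>" "\<kappa> \<nu>"] by (simp add: add.assoc)
  ultimately show ?thesis
    using assms by (simp add: spectrum_def sum.reindex)
qed

text \<open>For a fixed old frequency, the sum over \<open>L (Suc n)\<close> is 1 by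
  \<open>hadamard_triple_sum_mask\<close>; what remains is the Parseval identity of level
  \<open>n\<close>.\<close>

lemma spectrum_Suc:
  assumes "spectrum n \<Lambda>"
  obtains \<Lambda>' where "\<Lambda> \<subseteq> \<Lambda>'" "spectrum (Suc n) \<Lambda>'"
proof -
  have tr: "hadamard_triple (N (Suc n)) (B (Suc n)) (L (Suc n))"
    by (rule triple) simp
  then obtain l0 where l0: "l0 \<in> L (Suc n)"
    by (auto simp: hadamard_triple_def)
  \<comment> \<open>Subtracting \<open>l0\<close> makes 0 one of the translations, so that the old
    frequencies are kept.\<close>
  define f where "f = (\<lambda>(\<nu>, l). \<nu> + P n * (l - l0))"
  define \<Lambda>' where "\<Lambda>' = f ` (\<Lambda> \<times> L (Suc n))"
  have finL: "finite (L (Suc n))" and fin: "finite \<Lambda>"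
    using tr assms by (auto simp: hadamard_triple_def spectrum_def)
  have inj: "inj_on f (\<Lambda> \<times> L (Suc n))"
  proof (rule inj_onI, clarify)
    fix \<nu> l \<nu>' l'
    assume *: "\<nu> \<in> \<Lambda>" "\<nu>' \<in> \<Lambda>" "f (\<nu>, l) = f (\<nu>', l')"
    then have "\<nu> = \<nu>'"
      using spectrum_not_congruent[OF assms] by (auto simp: f_def)
    with * show "\<nu> = \<nu>' \<and> l = l'"
      using P_pos[of n] by (auto simp: f_def)
  qed
  have "(\<Sum>\<nu>\<in>\<Lambda>'. (cmod (partial_ft (Suc n) (\<xi> + real_of_int \<nu>)))\<^sup>2) = 1" for \<xi>
  proof -
    have P: "real_of_int (P n) > 0" "real_of_int (N (Suc n)) > 0"
      using P_pos[of n] N_ge_2[of "Suc n"] by auto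
    have term_eq: "(cmod (partial_ft (Suc n) (\<xi> + real_of_int (f (\<nu>, l)))))\<^sup>2 =
        (cmod (partial_ft n (\<xi> + real_of_int \<nu>)))\<^sup>2 *
        (cmod (mask (B (Suc n)) ((\<xi> + \<nu> - P n * l0) / P (Suc n) + l / N (Suc n))))\<^sup>2" for \<nu> l
    proof -
      have "partial_ft n (\<xi> + real_of_int (f (\<nu>, l))) = partial_ft n (\<xi> + real_of_int \<nu>)"
        using partial_ft_periodic[of n "\<xi> + real_of_int \<nu>" "l - l0"] by (simp add: f_def add.assoc)
      moreover have "factor (Suc n) (\<xi> + real_of_int (f (\<nu>, l)))
          = mask (B (Suc n)) ((\<xi> + \<nu> - P n * l0) / P (Suc n) + l / N (Suc n))"
        unfolding factor_def
        by (rule arg_cong[where f = "mask _"]) (use P in \<open>simp add: f_def P_Suc field_simps\<close>)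
      ultimately show ?thesis
        by (simp add: partial_ft_def norm_mult power_mult_distrib)
    qed
    have "(\<Sum>\<nu>\<in>\<Lambda>'. (cmod (partial_ft (Suc n) (\<xi> + real_of_int \<nu>)))\<^sup>2)
        = (\<Sum>\<nu>\<in>\<Lambda>. \<Sum>l\<in>L (Suc n). (cmod (partial_ft (Suc n) (\<xi> + real_of_int (f (\<nu>, l)))))\<^sup>2)"
      unfolding \<Lambda>'_def using inj by (simp add: sum.reindex sum.cartesian_product split_beta)
    also have "\<dots> = (\<Sum>\<nu>\<in>\<Lambda>. (cmod (partial_ft n (\<xi> + real_of_int \<nu>)))\<^sup>2)"
      unfolding term_eq sum_distrib_left [symmetric] hadamard_triple_sum_mask[OF tr] by simp
    also have "\<dots> = 1"
      using assms by (simp add: spectrum_def)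
    finally show ?thesis .
  qed
  then have "spectrum (Suc n) \<Lambda>'"
    using fin finL by (simp add: spectrum_def \<Lambda>'_def)
  moreover have "\<Lambda> \<subseteq> \<Lambda>'"
  proof
    fix \<nu> assume "\<nu> \<in> \<Lambda>"
    then have "f (\<nu>, l0) \<in> \<Lambda>'"
      using l0 by (auto simp: \<Lambda>'_def)
    then show "\<nu> \<in> \<Lambda>'"
      by (simp add: f_def)
  qed
  ultimately show thesis
    using that by blast
qed

lemma spectrum_extend:
  assumes "spectrum n \<Lambda>" "n \<le> m"
  obtains \<Lambda>' where "\<Lambda> \<subseteq> \<Lambda>'" "spectrum m \<Lambda>'"
proof -
  have "\<exists>\<Lambda>'. \<Lambda> \<subseteq> \<Lambda>' \<and> spectrum m \<Lambda>'"
    using assms(2)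
  proof (induction m rule: dec_induct)
    case base
    with assms show ?case by blast
  next
    case (step m)
    then show ?case
      by (meson order_trans spectrum_Suc)
  qed
  then show thesis
    using that by blast
qed

section \<open>Spectrality from equi-positivity\<close>

text \<open>The elements of \<open>\<Lambda>\<close> can stay in place, because \<open>tail_ft n'\<close> is close to 1 at them when \<open>n'\<close> is
  large.\<close>

lemma spectrum_step:
  fixes \<epsilon> \<delta> :: real
  assumes good: "\<forall>n0. \<exists>m\<ge>n0. \<forall>x. \<exists>k::int. 2 * \<epsilon> \<le> cmod (tail_ft m (x + real_of_int (P m * k)))"
    and eps: "0 < \<epsilon>" "\<epsilon> \<le> 1/4" and delta: "0 < \<delta>" "4 * pi * \<delta> \<le> \<epsilon>"
    and \<Lambda>: "spectrum n \<Lambda>"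
  obtains n' \<Lambda>' where "n < n'" "\<Lambda> \<subseteq> \<Lambda>'" "spectrum n' \<Lambda>'"
    "\<And>\<nu> h. \<nu> \<in> \<Lambda>' \<Longrightarrow> \<bar>h\<bar> \<le> \<delta> * P n' \<Longrightarrow> \<epsilon> \<le> cmod (tail_ft n' (h + real_of_int \<nu>))"
proof -
  have P: "real_of_int (P i) > 0" for i
    using P_pos[of i] by simp
  define R where "R = real_of_int (\<Sum>\<nu>\<in>\<Lambda>. \<bar>\<nu>\<bar>)"
  have fin: "finite \<Lambda>"
    using \<Lambda> by (simp add: spectrum_def)
  have R: "\<bar>real_of_int \<nu>\<bar> \<le> R" if "\<nu> \<in> \<Lambda>" for \<nu>
    unfolding R_def of_int_abs [symmetric] of_int_le_iff
    using fin that by (intro member_le_sum) auto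
  \<comment> \<open>As \<open>P m\<close> is at least 2^m, this puts \<open>tail_ft m\<close> within
    1/4 of 1 on \<open>\<Lambda>\<close>, so its modulus is at least 3/4, which exceeds
    \<open>2 * \<epsilon>\<close>.\<close>
  obtain j :: nat where j: "16 * pi * R < 2 ^ j"
    using real_arch_pow[of 2] by auto
  obtain m where m: "m \<ge> Suc n + j"
      "\<And>x. \<exists>k::int. 2 * \<epsilon> \<le> cmod (tail_ft m (x + real_of_int (P m * k)))"
    using good by blast
  have Pm: "16 * pi * R \<le> P m"
  proof -
    have "(2::real) ^ j \<le> 2 ^ m"
      using m(1) by (intro power_increasing) auto
    with j P_ge[of m] show ?thesis by linarith
  qed
  obtain \<kappa> :: "real \<Rightarrow> int" where \<kappa>: "\<And>x. 2 * \<epsilon> \<le> cmod (tail_ft m (x + real_of_int (P m * \<kappa> x)))"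
    using m(2) by metis
  obtain \<Lambda>1 where \<Lambda>1: "\<Lambda> \<subseteq> \<Lambda>1" "spectrum m \<Lambda>1"
    using spectrum_extend[OF \<Lambda>, of m] m(1) by auto
  define g where "g \<nu> = \<nu> + P m * (if \<nu> \<in> \<Lambda> then 0 else \<kappa> (real_of_int \<nu>))" for \<nu>
  have spec: "spectrum m (g ` \<Lambda>1)"
    unfolding g_def [abs_def] by (rule spectrum_shift[OF \<Lambda>1(2)])
  have sub: "\<Lambda> \<subseteq> g ` \<Lambda>1"
  proof
    fix \<nu> assume "\<nu> \<in> \<Lambda>"
    then have "g \<nu> = \<nu>" "\<nu> \<in> \<Lambda>1"
      using \<Lambda>1 by (auto simp: g_def)
    then show "\<nu> \<in> g ` \<Lambda>1" by (metis imageI)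
  qed
  have "\<epsilon> \<le> cmod (tail_ft m (h + real_of_int \<nu>))"
    if \<nu>: "\<nu> \<in> g ` \<Lambda>1" and h: "\<bar>h\<bar> \<le> \<delta> * P m" for \<nu> h
  proof -
    \<comment> \<open>The choice of \<open>\<delta>\<close> lets a perturbation by \<open>h\<close>
      cost at most \<open>\<epsilon>\<close> of the lower bound
      \<open>2 * \<epsilon>\<close>.\<close>
    have "4 * pi * \<bar>h\<bar> \<le> 4 * pi * (\<delta> * P m)"
      using h by (intro mult_left_mono) auto
    also have "\<dots> = (4 * pi * \<delta>) * P m" by simp
    also have "\<dots> \<le> \<epsilon> * P m"
      using delta P[of m] by (intro mult_right_mono) auto
    finally have "4 * pi * \<bar>h\<bar> / P m \<le> \<epsilon>"
      using P[of m] by (simp add: divide_le_eq)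
    then have h': "cmod (tail_ft m (h + y) - tail_ft m y) \<le> \<epsilon>" for y
      using cmod_tail_ft_diff_le[of m "h + y" y] by simp
    obtain \<nu>1 where \<nu>1: "\<nu>1 \<in> \<Lambda>1" "\<nu> = g \<nu>1"
      using \<nu> by blast
    have "2 * \<epsilon> \<le> cmod (tail_ft m (real_of_int \<nu>))"
    proof (cases "\<nu>1 \<in> \<Lambda>")
      case True
      then have \<nu>_in: "\<nu> \<in> \<Lambda>"
        using \<nu>1 by (simp add: g_def)
      have "4 * pi * \<bar>real_of_int \<nu>\<bar> \<le> 4 * pi * R"
        using R[OF \<nu>_in] by (intro mult_left_mono) auto
      then have "4 * pi * \<bar>real_of_int \<nu>\<bar> / P m \<le> 1 / 4"
        using Pm unfolding pos_divide_le_eq[OF P] by linarith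
      then have "cmod (tail_ft m (real_of_int \<nu>) - tail_ft m 0) \<le> 1 / 4"
        using cmod_tail_ft_diff_le[of m "real_of_int \<nu>" 0] by simp
      then have "cmod (1 - tail_ft m (real_of_int \<nu>)) \<le> 1 / 4"
        by (simp add: norm_minus_commute)
      then show ?thesis
        using norm_triangle_ineq2[of 1 "tail_ft m (real_of_int \<nu>)"] eps by simp
    next
      case False
      then show ?thesis
        using \<kappa>[of "real_of_int \<nu>1"] \<nu>1 by (simp add: g_def)
    qed
    then show ?thesis
      using h'[of "real_of_int \<nu>"] norm_triangle_ineq2[of "tail_ft m (real_of_int \<nu>)" "tail_ft m (h + real_of_int \<nu>)"]
      by (simp add: norm_minus_commute)
  qed
  then show thesis
    using m(1) sub spec by (intro that[of m "g ` \<Lambda>1"]) auto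
qed

text \<open>\<open>spectrum_step\<close> is iterated by dependent choice.\<close>

lemma increasing_spectra:
  fixes \<epsilon> \<delta> :: real
  assumes good: "\<forall>n0. \<exists>m\<ge>n0. \<forall>x. \<exists>k::int. 2 * \<epsilon> \<le> cmod (tail_ft m (x + real_of_int (P m * k)))"
    and eps: "0 < \<epsilon>" "\<epsilon> \<le> 1/4" and delta: "0 < \<delta>" "4 * pi * \<delta> \<le> \<epsilon>"
  obtains n :: "nat \<Rightarrow> nat" and \<Lambda> :: "nat \<Rightarrow> int set"
  where "strict_mono n" "mono \<Lambda>" "\<And>i. spectrum (n i) (\<Lambda> i)"
    "\<And>i \<nu> h. \<nu> \<in> \<Lambda> i \<Longrightarrow> \<bar>h\<bar> \<le> \<delta> * P (n i) \<Longrightarrow> \<epsilon> \<le> cmod (tail_ft (n i) (h + real_of_int \<nu>))"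
proof -
  define R where "R = (\<lambda>(n, \<Lambda>). spectrum n \<Lambda> \<and>
    (\<forall>\<nu>\<in>\<Lambda>. \<forall>h. \<bar>h\<bar> \<le> \<delta> * P n \<longrightarrow> \<epsilon> \<le> cmod (tail_ft n (h + real_of_int \<nu>))))"
  have step: "\<exists>y. R y \<and> fst x < fst y \<and> snd x \<subseteq> snd y" if spec: "spectrum (fst x) (snd x)" for x
  proof -
    obtain n' \<Lambda>' where "fst x < n'" "snd x \<subseteq> \<Lambda>'" "spectrum n' \<Lambda>'"
      "\<And>\<nu> h. \<nu> \<in> \<Lambda>' \<Longrightarrow> \<bar>h\<bar> \<le> \<delta> * P n' \<Longrightarrow> \<epsilon> \<le> cmod (tail_ft n' (h + real_of_int \<nu>))"
      by (rule spectrum_step[OF good eps delta spec]) (rule that)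
    then show ?thesis
      by (intro exI[of _ "(n', \<Lambda>')"]) (auto simp: R_def)
  qed
  \<comment> \<open>The pair of 0 and \<open>{0}\<close> need not satisfy \<open>R\<close>, but a
    step only requires a spectrum, so one step from it gives a starting point.\<close>
  have "\<exists>y. R y"
    using step[of "(0, {0})"] spectrum_0 by auto
  moreover have "\<exists>y. R y \<and> (fst x < fst y \<and> snd x \<subseteq> snd y)" if "R x" for x
    using step[of x] that by (auto simp: R_def)
  ultimately obtain s where s: "\<And>i. R (s i)" "\<And>i. fst (s i) < fst (s (Suc i)) \<and> snd (s i) \<subseteq> snd (s (Suc i))"
    using dependent_nat_choice[of "\<lambda>_. R" "\<lambda>_ x y. fst x < fst y \<and> snd x \<subseteq> snd y"] by metis
  show thesis
  proof (rule that[of "\<lambda>i. fst (s i)" "\<lambda>i. snd (s i)"])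
    show "strict_mono (\<lambda>i. fst (s i))"
      using s(2) by (simp add: strict_mono_Suc_iff)
    show "mono (\<lambda>i. snd (s i))"
      using s(2) by (simp add: mono_iff_le_Suc)
  qed (use s(1) in \<open>auto simp: R_def split_beta\<close>)
qed

text \<open>No mass is lost in the limit. The terms \<open>p j\<close> of the finite Parseval
  identities converge pointwise to \<open>f\<close>, and the lower bound on the tail transform gives
  the summable majorant f / \<epsilon>^2; the proof is dominated convergence done by hand.\<close>

lemma sum_square_tail_ft_tendsto:
  fixes n :: "nat \<Rightarrow> nat" and \<Lambda> :: "nat \<Rightarrow> int set" and \<epsilon> \<delta> :: real
  assumes n: "strict_mono n" and mono: "mono \<Lambda>" and spec: "\<And>i. spectrum (n i) (\<Lambda> i)"
    and pos: "\<And>i \<nu> h. \<nu> \<in> \<Lambda> i \<Longrightarrow> \<bar>h\<bar> \<le> \<delta> * P (n i) \<Longrightarrow> \<epsilon> \<le> cmod (tail_ft (n i) (h + real_of_int \<nu>))"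
    and eps: "0 < \<epsilon>" and delta: "0 < \<delta>"
  shows "(\<lambda>i. \<Sum>\<nu>\<in>\<Lambda> i. (cmod (tail_ft 0 (\<xi> + real_of_int \<nu>)))\<^sup>2) \<longlonglongrightarrow> 1"
proof -
  define f where "f \<nu> = (cmod (tail_ft 0 (\<xi> + real_of_int \<nu>)))\<^sup>2" for \<nu> :: int
  define p where "p i \<nu> = (cmod (partial_ft (n i) (\<xi> + real_of_int \<nu>)))\<^sup>2" for i and \<nu> :: int
  define Q where "Q i = sum f (\<Lambda> i)" for i
  have fin: "finite (\<Lambda> i)" and p1: "sum (p i) (\<Lambda> i) = 1" for i
    using spec[of i] by (auto simp: spectrum_def p_def)
  have sub: "\<Lambda> i \<subseteq> \<Lambda> j" if "i \<le> j" for i j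
    using mono that by (auto dest: monoD)
  have f_eq: "f \<nu> = p i \<nu> * (cmod (tail_ft (n i) (\<xi> + real_of_int \<nu>)))\<^sup>2" for i \<nu>
    unfolding f_def p_def by (subst partial_ft_tail_ft[of _ "n i"]) (simp add: norm_mult power_mult_distrib)
  have f_le: "f \<nu> \<le> p i \<nu>" for i \<nu>
  proof -
    have "(cmod (tail_ft (n i) (\<xi> + real_of_int \<nu>)))\<^sup>2 \<le> 1"
      by (simp add: cmod_tail_ft_le_1 power_le_one)
    then show ?thesis
      unfolding f_eq[of \<nu> i] by (intro mult_left_le) (auto simp: p_def)
  qed
  have Q_le: "Q i \<le> 1" for i
    using sum_mono[of "\<Lambda> i" f "p i"] f_le p1[of i] by (simp add: Q_def)
  have "incseq Q"
    unfolding Q_def incseq_def using sub fin by (auto intro!: sum_mono2 simp: f_def)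
  then obtain q where q: "Q \<longlonglongrightarrow> q" "\<And>i. Q i \<le> q"
    using incseq_convergent[of Q 1] Q_le by metis
  have "\<forall>\<^sub>F j in sequentially. \<bar>\<xi>\<bar> / \<delta> \<le> P (n j)"
  proof -
    obtain k :: nat where k: "\<bar>\<xi>\<bar> / \<delta> < 2 ^ k"
      using real_arch_pow[of 2] by auto
    have "\<bar>\<xi>\<bar> / \<delta> \<le> P (n j)" if "j \<ge> k" for j
    proof -
      have "(2::real) ^ k \<le> 2 ^ n j"
        using that seq_suble[OF n, of j] by (intro power_increasing) auto
      with k P_ge[of "n j"] show ?thesis by linarith
    qed
    then show ?thesis
      by (rule eventually_sequentiallyI)
  qed
  \<comment> \<open>For large \<open>j\<close> the point \<open>\<xi>\<close> lies within the radius
    \<open>\<delta> * P (n j)\<close>, so \<open>pos\<close> applies with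
    \<open>h = \<xi>\<close>.\<close>
  then have p_le: "\<forall>\<^sub>F j in sequentially. \<forall>\<nu>\<in>\<Lambda> j. p j \<nu> \<le> f \<nu> / \<epsilon>\<^sup>2"
  proof eventually_elim
    case (elim j)
    show ?case
    proof
      fix \<nu> assume "\<nu> \<in> \<Lambda> j"
      moreover have "\<bar>\<xi>\<bar> \<le> \<delta> * P (n j)"
        using elim delta by (simp add: divide_le_eq mult.commute)
      ultimately have "\<epsilon>\<^sup>2 \<le> (cmod (tail_ft (n j) (\<xi> + real_of_int \<nu>)))\<^sup>2"
        using pos eps by (intro power_mono) auto
      then have "p j \<nu> * \<epsilon>\<^sup>2 \<le> f \<nu>"
        unfolding f_eq[of \<nu> j] by (intro mult_left_mono) (auto simp: p_def)
      then show "p j \<nu> \<le> f \<nu> / \<epsilon>\<^sup>2"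
        using eps by (simp add: le_divide_eq)
    qed
  qed
  \<comment> \<open>Split the Parseval sum of level \<open>n j\<close> at \<open>\<Lambda> i\<close>
    and let \<open>j\<close> grow with \<open>i\<close> fixed. Afterwards \<open>i\<close> grows,
    and the error term vanishes because \<open>Q\<close> tends to \<open>q\<close>.\<close>
  have "1 \<le> Q i + (q - Q i) / \<epsilon>\<^sup>2" for i
  proof (rule tendsto_lowerbound)
    have "(\<lambda>j. p j \<nu>) \<longlonglongrightarrow> f \<nu>" for \<nu>
      unfolding p_def f_def
      using LIMSEQ_subseq_LIMSEQ[OF partial_ft_tendsto n]
      by (intro tendsto_intros) (simp add: o_def)
    then show "(\<lambda>j. sum (p j) (\<Lambda> i) + (q - Q i) / \<epsilon>\<^sup>2) \<longlonglongrightarrow> Q i + (q - Q i) / \<epsilon>\<^sup>2"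
      unfolding Q_def by (intro tendsto_intros)
    show "\<forall>\<^sub>F j in sequentially. 1 \<le> sum (p j) (\<Lambda> i) + (q - Q i) / \<epsilon>\<^sup>2"
      using p_le eventually_ge_at_top[of i]
    proof eventually_elim
      case (elim j)
      note ij = sub[OF elim(2)]
      have "1 = sum (p j) (\<Lambda> i) + sum (p j) (\<Lambda> j - \<Lambda> i)"
        using p1[of j] sum.subset_diff[OF ij fin, of "p j"] by simp
      also have "sum (p j) (\<Lambda> j - \<Lambda> i) \<le> (\<Sum>\<nu>\<in>\<Lambda> j - \<Lambda> i. f \<nu> / \<epsilon>\<^sup>2)"
        using elim(1) by (intro sum_mono) auto
      also have "\<dots> = (Q j - Q i) / \<epsilon>\<^sup>2"
        using sum.subset_diff[OF ij fin, of f] by (simp add: Q_def sum_divide_distrib [symmetric])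
      also have "\<dots> \<le> (q - Q i) / \<epsilon>\<^sup>2"
        using q(2)[of j] by (intro divide_right_mono) auto
      finally show ?case by simp
    qed
  qed simp
  moreover have "(\<lambda>i. Q i + (q - Q i) / \<epsilon>\<^sup>2) \<longlonglongrightarrow> q + (q - q) / \<epsilon>\<^sup>2"
    using eps by (intro tendsto_intros q) auto
  ultimately have "1 \<le> q + (q - q) / \<epsilon>\<^sup>2"
    by (intro tendsto_lowerbound[of _ _ sequentially]) auto
  moreover have "q \<le> 1"
    using q(1) Q_le by (intro tendsto_upperbound[of Q q sequentially]) auto
  ultimately have "q = 1" by simp
  with q(1) show ?thesis
    by (simp add: Q_def [abs_def] f_def)
qed

section \<open>From the Parseval identity to an orthonormal basis\<close>

lemma l2_inner_expo:
  "l2_inner (cantor_moran N B) (expo s) (expo t) = tail_ft 0 (s - t)"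
proof -
  have "expo s x * cnj (expo t x) = iexp (2 * pi * (s - t) * x)" for x
    by (simp add: cnj_expo expo_add [symmetric]) (simp add: expo_eq_cis cis_conv_exp)
  then show ?thesis
    by (simp add: l2_inner_def tail_ft_def char_def tail_measure_0)
qed

end

text \<open>For Fourier coefficients \<open>c\<close> both cross terms and the quadratic term equal
  the sum of the |c i|^2. An exponential whose Parseval sum tends to 1 is therefore
  approximable.\<close>

lemma (in real_distribution) integral_square_minus_projection:
  fixes c :: "real \<Rightarrow> complex"
  assumes "finite S"
    and orth: "\<And>i j. i \<in> S \<Longrightarrow> j \<in> S \<Longrightarrow> l2_inner M (expo i) (expo j) = (if i = j then 1 else 0)"
    and c: "\<And>i. i \<in> S \<Longrightarrow> c i = l2_inner M (expo t) (expo i)"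
  shows "(LINT x|M. (cmod (expo t x - (\<Sum>i\<in>S. c i * expo i x)))\<^sup>2) = 1 - (\<Sum>i\<in>S. (cmod (c i))\<^sup>2)"
proof -
  have int: "integrable M (\<lambda>x. expo s x * cnj (expo u x))" for s u
    by (intro integrable_const_bound[where B = 1]) (auto simp: norm_mult cnj_expo)
  have "complex_of_real (LINT x|M. (cmod (expo t x - (\<Sum>i\<in>S. c i * expo i x)))\<^sup>2)
      = (LINT x|M. (expo t x - (\<Sum>i\<in>S. c i * expo i x)) * cnj (expo t x - (\<Sum>i\<in>S. c i * expo i x)))"
    by (simp only: integral_complex_of_real [symmetric] complex_norm_square)
  also have "\<dots> = (LINT x|M. expo t x * cnj (expo t x) - (\<Sum>i\<in>S. cnj (c i) * (expo t x * cnj (expo i x)))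
      - (\<Sum>i\<in>S. c i * cnj (expo t x * cnj (expo i x)))
      + (\<Sum>i\<in>S. \<Sum>j\<in>S. c i * cnj (c j) * (expo i x * cnj (expo j x))))"
  proof (intro Bochner_Integration.integral_cong refl)
    fix x
    let ?g = "\<Sum>i\<in>S. c i * expo i x"
    have "(expo t x - ?g) * cnj (expo t x - ?g)
        = expo t x * cnj (expo t x) - expo t x * cnj ?g - ?g * cnj (expo t x) + ?g * cnj ?g"
      by (simp only: complex_cnj_diff) (simp only: algebra_simps)
    moreover have "expo t x * cnj ?g = (\<Sum>i\<in>S. cnj (c i) * (expo t x * cnj (expo i x)))"
      unfolding cnj_sum sum_distrib_left by (simp add: mult_ac)
    moreover have "?g * cnj (expo t x) = (\<Sum>i\<in>S. c i * cnj (expo t x * cnj (expo i x)))"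
      unfolding sum_distrib_right by (simp add: mult_ac)
    moreover have "?g * cnj ?g = (\<Sum>i\<in>S. \<Sum>j\<in>S. c i * cnj (c j) * (expo i x * cnj (expo j x)))"
      unfolding cnj_sum sum_product by (simp add: mult_ac)
    ultimately show "(expo t x - ?g) * cnj (expo t x - ?g) = expo t x * cnj (expo t x)
      - (\<Sum>i\<in>S. cnj (c i) * (expo t x * cnj (expo i x)))
      - (\<Sum>i\<in>S. c i * cnj (expo t x * cnj (expo i x)))
      + (\<Sum>i\<in>S. \<Sum>j\<in>S. c i * cnj (c j) * (expo i x * cnj (expo j x)))"
      by simp
  qed
  also have "\<dots> = (LINT x|M. expo t x * cnj (expo t x)) - (\<Sum>i\<in>S. cnj (c i) * l2_inner M (expo t) (expo i))
      - (\<Sum>i\<in>S. c i * cnj (l2_inner M (expo t) (expo i)))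
      + (\<Sum>i\<in>S. \<Sum>j\<in>S. c i * cnj (c j) * l2_inner M (expo i) (expo j))"
    unfolding l2_inner_def using int
    by (simp add: Bochner_Integration.integral_sum integral_cnj del: complex_cnj_mult)
  also have "(LINT x|M. expo t x * cnj (expo t x)) = 1"
    using prob_space by (simp add: complex_norm_square [symmetric])
  also have "(\<Sum>i\<in>S. \<Sum>j\<in>S. c i * cnj (c j) * l2_inner M (expo i) (expo j)) = (\<Sum>i\<in>S. c i * cnj (c i))"
  proof (intro sum.cong refl)
    fix i assume i: "i \<in> S"
    have "(\<Sum>j\<in>S. c i * cnj (c j) * l2_inner M (expo i) (expo j)) = (\<Sum>j\<in>S. if i = j then c i * cnj (c j) else 0)"
      using i by (intro sum.cong) (auto simp: orth)
    then show "(\<Sum>j\<in>S. c i * cnj (c j) * l2_inner M (expo i) (expo j)) = c i * cnj (c i)"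
      using i assms(1) by simp
  qed
  also have "(\<Sum>i\<in>S. cnj (c i) * l2_inner M (expo t) (expo i)) = (\<Sum>i\<in>S. c i * cnj (c i))"
    by (intro sum.cong) (auto simp: c)
  also have "(\<Sum>i\<in>S. c i * cnj (l2_inner M (expo t) (expo i))) = (\<Sum>i\<in>S. c i * cnj (c i))"
    by (intro sum.cong) (auto simp: c)
  also have "1 - (\<Sum>i\<in>S. c i * cnj (c i)) - (\<Sum>i\<in>S. c i * cnj (c i)) + (\<Sum>i\<in>S. c i * cnj (c i))
      = complex_of_real (1 - (\<Sum>i\<in>S. (cmod (c i))\<^sup>2))"
    by (simp add: complex_norm_square [symmetric])
  finally show ?thesis
    unfolding of_real_eq_iff .
qed

context hadamard_sequence
begin

text \<open>The spectrum is the union of the increasing finite spectra. Two of its elements lie in a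
  common finite spectrum, where the finite transform already vanishes at their difference;
  completeness follows from the limiting Parseval identity and the density of exponentials.\<close>

theorem spectral_if_equipositive:
  fixes \<epsilon> :: real
  assumes good: "\<forall>n0. \<exists>m\<ge>n0. \<forall>x. \<exists>k::int. 2 * \<epsilon> \<le> cmod (tail_ft m (x + real_of_int (P m * k)))"
    and eps: "0 < \<epsilon>" "\<epsilon> \<le> 1/4"
  shows "spectral_measure (cantor_moran N B)"
proof -
  let ?\<mu> = "cantor_moran N B"
  interpret real_distribution ?\<mu>
    using tail_measure_props(1)[of 0] by (simp add: tail_measure_0)
  define \<delta> where "\<delta> = \<epsilon> / (4 * pi)"
  have delta: "0 < \<delta>" "4 * pi * \<delta> \<le> \<epsilon>"
    using eps by (auto simp: \<delta>_def)
  obtain n :: "nat \<Rightarrow> nat" and \<Lambda> :: "nat \<Rightarrow> int set"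
    where n: "strict_mono n" and \<Lambda>: "mono \<Lambda>" and spec: "\<And>i. spectrum (n i) (\<Lambda> i)"
    and pos: "\<And>i \<nu> h. \<nu> \<in> \<Lambda> i \<Longrightarrow> \<bar>h\<bar> \<le> \<delta> * P (n i) \<Longrightarrow> \<epsilon> \<le> cmod (tail_ft (n i) (h + real_of_int \<nu>))"
    by (rule increasing_spectra[OF good eps delta]) (rule that)
  define \<Gamma> where "\<Gamma> i = real_of_int ` \<Lambda> i" for i
  define \<Gamma>' where "\<Gamma>' = (\<Union>i. \<Gamma> i)"
  have orth_i: "l2_inner ?\<mu> (expo s) (expo t) = (if s = t then 1 else 0)" if st: "s \<in> \<Gamma> i" "t \<in> \<Gamma> i" for s t i
  proof (cases "s = t")
    case False
    obtain \<nu> \<nu>' where "\<nu> \<in> \<Lambda> i" "\<nu>' \<in> \<Lambda> i" "s = real_of_int \<nu>" "t = real_of_int \<nu>'"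
      using st by (auto simp: \<Gamma>_def)
    then have "partial_ft (n i) (s - t) = 0"
      using spectrum_orthogonal[OF spec[of i], of \<nu> \<nu>'] False by auto
    then show ?thesis
      using False by (simp add: l2_inner_expo partial_ft_tail_ft[of _ "n i"])
  qed (simp add: l2_inner_expo)
  have approx_expo: "l2_approximable ?\<mu> \<Gamma>' (expo t)" for t
    unfolding l2_approximable_def
  proof (intro conjI allI impI)
    fix e :: real assume "e > 0"
    \<comment> \<open>The base point is \<open>- t\<close>, because the coefficient of
      \<open>expo t\<close> at \<open>\<nu>\<close> is the conjugate of the transform at
      \<open>\<nu> - t\<close>.\<close>
    have "(\<lambda>i. \<Sum>\<nu>\<in>\<Lambda> i. (cmod (tail_ft 0 (- t + real_of_int \<nu>)))\<^sup>2) \<longlonglongrightarrow> 1"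
      by (rule sum_square_tail_ft_tendsto[OF n \<Lambda> spec pos eps(1) delta(1)])
    then have "\<forall>\<^sub>F i in sequentially. 1 - e < (\<Sum>\<nu>\<in>\<Lambda> i. (cmod (tail_ft 0 (- t + real_of_int \<nu>)))\<^sup>2)"
      using \<open>e > 0\<close> by (intro order_tendstoD) auto
    then obtain i where i: "1 - e < (\<Sum>\<nu>\<in>\<Lambda> i. (cmod (tail_ft 0 (- t + real_of_int \<nu>)))\<^sup>2)"
      using eventually_happens'[OF sequentially_bot] by blast
    define c where "c s = l2_inner ?\<mu> (expo t) (expo s)" for s
    have fin: "finite (\<Gamma> i)"
      using spec[of i] by (simp add: \<Gamma>_def spectrum_def)
    have "cmod (c (real_of_int \<nu>)) = cmod (tail_ft 0 (- t + real_of_int \<nu>))" for \<nu>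
    proof -
      have "cnj (l2_inner ?\<mu> (expo (real_of_int \<nu>)) (expo t))
          = (LINT x|?\<mu>. cnj (expo (real_of_int \<nu>) x * cnj (expo t x)))"
        unfolding l2_inner_def by (rule Bochner_Integration.integral_cnj [symmetric])
      then have "c (real_of_int \<nu>) = cnj (l2_inner ?\<mu> (expo (real_of_int \<nu>)) (expo t))"
        by (simp add: c_def l2_inner_def mult.commute)
      then show ?thesis
        by (simp add: l2_inner_expo)
    qed
    then have "(\<Sum>s\<in>\<Gamma> i. (cmod (c s))\<^sup>2) = (\<Sum>\<nu>\<in>\<Lambda> i. (cmod (tail_ft 0 (- t + real_of_int \<nu>)))\<^sup>2)"
      unfolding \<Gamma>_def by (subst sum.reindex) (auto simp: inj_on_def)
    with i have "(LINT x|?\<mu>. (cmod (expo t x - (\<Sum>s\<in>\<Gamma> i. c s * expo s x)))\<^sup>2) < e"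
      by (subst integral_square_minus_projection[OF fin orth_i]) (auto simp: c_def)
    then show "\<exists>S c. finite S \<and> S \<subseteq> \<Gamma>' \<and>
        (LINT x|?\<mu>. (cmod (expo t x - (\<Sum>i\<in>S. c i * expo i x)))\<^sup>2) < e"
      using fin by (intro exI[of _ "\<Gamma> i"] exI[of _ c]) (auto simp: \<Gamma>'_def)
  qed simp
  have approx: "l2_approximable ?\<mu> \<Gamma>' f" if "square_integrable ?\<mu> f" for f
    using tail_measure_props(3)[of 0] unfolding tail_measure_0
    by (rule l2_approximable_if_expo[OF _ approx_expo that])
  have orth: "l2_inner ?\<mu> (expo s) (expo t) = (if s = t then 1 else 0)" if st: "s \<in> \<Gamma>'" "t \<in> \<Gamma>'" for s t
  proof -
    obtain i j where "s \<in> \<Gamma> i" "t \<in> \<Gamma> j"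
      using st by (auto simp: \<Gamma>'_def)
    moreover have "\<Lambda> i \<subseteq> \<Lambda> (max i j)" "\<Lambda> j \<subseteq> \<Lambda> (max i j)"
      using \<Lambda> by (simp_all add: monoD)
    ultimately have "s \<in> \<Gamma> (max i j)" "t \<in> \<Gamma> (max i j)"
      by (auto simp: \<Gamma>_def)
    then show ?thesis by (rule orth_i)
  qed
  have "l2_orthonormal_basis ?\<mu> \<Gamma>' expo"
    unfolding l2_orthonormal_basis_def
  proof (intro conjI ballI allI impI)
    fix f and e :: real
    assume "square_integrable ?\<mu> f" "0 < e"
    \<comment> \<open>The tolerance is squared, because \<open>l2_approximable\<close> bounds the
      squared norm.\<close>
    then obtain S c where S: "finite S" "S \<subseteq> \<Gamma>'"
        "(LINT x|?\<mu>. (cmod (f x - (\<Sum>i\<in>S. c i * expo i x)))\<^sup>2) < e\<^sup>2"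
      using approx[of f] unfolding l2_approximable_def by (meson zero_less_power)
    from S(3) have "sqrt (LINT x|?\<mu>. (cmod (f x - (\<Sum>i\<in>S. c i * expo i x)))\<^sup>2) < e"
      using \<open>0 < e\<close> by (intro real_less_lsqrt) auto
    with S show "\<exists>S c. finite S \<and> S \<subseteq> \<Gamma>' \<and>
        sqrt (LINT x|?\<mu>. (cmod (f x - (\<Sum>i\<in>S. c i * expo i x)))\<^sup>2) < e"
      by blast
  qed (use orth in auto)
  moreover have "countable \<Gamma>'"
    by (auto simp: \<Gamma>'_def \<Gamma>_def)
  ultimately show ?thesis
    unfolding spectral_measure_def using real_distribution_axioms by blast
qed

end

section \<open>Equi-positivity\<close>

text \<open>For \<open>d\<close> different from 0 this is a full geometric sum over an N-th root of
  unity, which is not 1 because |d| < N.\<close>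

lemma sum_expo_period:
  assumes "\<bar>d\<bar> < N" "N > (0 :: int)"
  shows "(\<Sum>k<nat N. expo ((x + real k) / real_of_int N) (real_of_int d)) = (if d = 0 then of_int N else 0)"
proof (cases "d = 0")
  case False
  define z where "z = cis (2 * pi * (d / N))"
  have "expo ((x + real k) / real_of_int N) (real_of_int d) = expo (x / N) d * z ^ k" for k
    by (simp add: z_def expo_eq_cis Complex.DeMoivre cis_mult add_divide_distrib ring_distribs mult_ac)
  then have "(\<Sum>k<nat N. expo ((x + real k) / real_of_int N) (real_of_int d)) = expo (x / N) d * (\<Sum>k<nat N. z ^ k)"
    by (simp add: sum_distrib_left)
  also have "(\<Sum>k<nat N. z ^ k) = 0"
  proof -
    have "z \<noteq> 1"
    proof
      assume "z = 1"
      then have "exp (2 * of_real pi * \<i> * complex_of_real (d / N)) = 1"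
        by (simp add: z_def cis_conv_exp mult_ac)
      then obtain n :: int where "2 * pi * (d / N) = real_of_int (2 * n) * pi"
        by (auto simp: exp_eq_1 mult_ac)
      then have "real_of_int d = real_of_int (n * N)"
        using assms(2) by (simp add: field_simps)
      then have "d = n * N"
        by (simp only: of_int_eq_iff)
      with False assms show False
        by (metis abs_mult abs_of_pos dvd_triv_right zdvd_not_zless zero_less_abs_iff dvd_abs_iff)
    qed
    moreover have "z ^ nat N = 1"
    proof -
      have "z ^ nat N = expo d 1"
        using assms(2) by (simp add: z_def expo_eq_cis Complex.DeMoivre)
      then show ?thesis
        using expo_int_int[of d 1] by simp
    qed
    ultimately show ?thesis
      by (simp add: geometric_sum)
  qed
  finally show ?thesis
    using False by simp
qed (use assms in auto)

text \<open>The residue \<open>r\<close> avoids \<open>0\<close> and \<open>N\<close>, so that the corresponding Fourier coefficient of the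
  product on the arithmetic progression is a sum of nonnegative terms without phases.\<close>

lemma mask_times_limit_large:
  assumes B: "B \<subseteq> {0..N - 1}" "B \<noteq> {}" and N: "N \<ge> 2"
  obtains (large) k where "k < nat N"
    "1 / (2 * real (card B)) \<le> cmod (mask B ((x + real k) / N)) * cmod ((1 + expo ((x + real k) / N) 1) / 2)"
proof (rule ccontr)
  assume "\<not> thesis"
  define M where "M = card B"
  have fin: "finite B"
    using B(1) by (rule finite_subset) simp
  then have M: "M > 0"
    using B(2) by (simp add: M_def card_gt_0_iff)
  define y where "y k = (x + real k) / N" for k
  define g where "g k = mask B (y k) * ((1 + expo (y k) 1) / 2)" for k
  have small: "cmod (g k) < 1 / (2 * M)" if "k < nat N" for k
    using \<open>\<not> thesis\<close> large[of k] that unfolding g_def y_def M_def norm_mult by force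
  obtain b0 where b0: "b0 \<in> B" using B(2) by blast
  define r where "r = (if b0 = 0 then 1 else b0)"
  have r: "1 \<le> r" "r \<le> N - 1" "r \<in> B \<or> r - 1 \<in> B"
    using b0 B(1) N by (auto simp: r_def)
  \<comment> \<open>A digit \<open>b\<close> yields the frequencies \<open>b\<close> and
    \<open>b + 1\<close> in the product; \<open>w b\<close> counts how many of them equal
    \<open>r\<close>.\<close>
  define w where "w b = (if b = r then 1 else 0) + (if b + 1 = r then 1 else (0 :: real))" for b
  have "g k * expo (- y k) r = (\<Sum>b\<in>B. expo (y k) (real_of_int (b - r)) + expo (y k) (real_of_int (b + 1 - r))) / of_nat (2 * M)" for k
  proof -
    have e: "expo (- y k) r = expo (y k) (- real_of_int r)"
      by (simp add: expo_eq_cis)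
    have "(\<Sum>b\<in>B. expo (y k) (real_of_int (b - r)) + expo (y k) (real_of_int (b + 1 - r)))
        = (\<Sum>b\<in>B. expo (y k) b) * ((1 + expo (y k) 1) * expo (y k) (- real_of_int r))"
      unfolding sum_distrib_right
      by (intro sum.cong refl) (simp add: algebra_simps expo_add_right [symmetric])
    then show ?thesis
      by (simp add: g_def mask_def M_def [symmetric] e mult_ac)
  qed
  \<comment> \<open>The discrete Fourier coefficient at \<open>r\<close>, up to the factor N: by
    \<open>sum_expo_period\<close> only the terms of frequency exactly \<open>r\<close>
    survive.\<close>
  then have "(\<Sum>k<nat N. g k * expo (- y k) r)
      = (\<Sum>b\<in>B. (\<Sum>k<nat N. expo (y k) (real_of_int (b - r))) + (\<Sum>k<nat N. expo (y k) (real_of_int (b + 1 - r)))) / of_nat (2 * M)"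
    by (simp add: sum_divide_distrib [symmetric] sum.distrib [symmetric] del: of_int_diff of_int_add)
      (rule disjI2, rule sum.swap)
  also have "(\<Sum>b\<in>B. (\<Sum>k<nat N. expo (y k) (real_of_int (b - r))) + (\<Sum>k<nat N. expo (y k) (real_of_int (b + 1 - r))))
      = (\<Sum>b\<in>B. of_real (N * w b))"
  proof (intro sum.cong refl)
    fix b assume "b \<in> B"
    then have "0 \<le> b" "b \<le> N - 1" using B(1) by auto
    with r have "\<bar>b - r\<bar> < N" "\<bar>b + 1 - r\<bar> < N" by auto
    then show "(\<Sum>k<nat N. expo (y k) (real_of_int (b - r))) + (\<Sum>k<nat N. expo (y k) (real_of_int (b + 1 - r))) = of_real (N * w b)"
      unfolding y_def using N by (subst (1 2) sum_expo_period) (auto simp: w_def)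
  qed
  also have "\<dots> / of_nat (2 * M) = complex_of_real (N * sum w B / (2 * M))"
    by (simp add: sum_distrib_left)
  finally have eq: "(\<Sum>k<nat N. g k * expo (- y k) r) = complex_of_real (N * sum w B / (2 * M))" .
  have "1 \<le> sum w B"
  proof -
    obtain b where b: "b \<in> B" "1 \<le> w b"
      using r(3) by (auto simp: w_def)
    have "w b \<le> sum w B"
      using b(1) fin by (intro member_le_sum) (auto simp: w_def)
    with b show ?thesis by simp
  qed
  \<comment> \<open>The coefficient is at most the sum of the N moduli, so they cannot all lie below
    1 / (2 M).\<close>
  then have "N / (2 * M) \<le> N * sum w B / (2 * M)"
    using N by (intro divide_right_mono) auto
  also have "\<dots> \<le> cmod (\<Sum>k<nat N. g k * expo (- y k) r)"
    unfolding eq norm_of_real by (rule abs_ge_self)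
  also have "\<dots> \<le> (\<Sum>k<nat N. cmod (g k))"
    using norm_sum[of "\<lambda>k. g k * expo (- y k) r" "{..<nat N}"] by (simp add: norm_mult)
  also have "\<dots> < (\<Sum>k<nat N. 1 / (2 * M))"
    using N small by (intro sum_strict_mono) (auto simp: lessThan_empty_iff)
  also have "\<dots> = N / (2 * M)"
    using N by simp
  finally show False by simp
qed

context hadamard_sequence
begin

text \<open>One mask factor is split off the tail, and the remaining tail is replaced by its limit.
  The product with the limit reaches 1 / (2 M) somewhere on the progression, and the replacement
  costs at most 1 / (4 M).\<close>

lemma equipositive_at:
  assumes M: "card (B (Suc m)) \<le> M"
    and close: "\<And>y :: real. y \<in> {0..1} \<Longrightarrow>
      cmod (tail_ft (Suc m) (P (Suc m) * y) - (1 + expo y 1) / 2) \<le> 1 / (4 * real M)"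
  shows "\<exists>k::int. 1 / (4 * real M) \<le> cmod (tail_ft m (x + real_of_int (P m * k)))"
proof -
  define u where "u = x / P m"
  have P: "real_of_int (P m) > 0" "real_of_int (N (Suc m)) > 0"
    using P_pos[of m] N_ge_2[of "Suc m"] by auto
  have card: "card (B (Suc m)) > 0"
    using B_finite[of "Suc m"] B_nonempty[of "Suc m"] by (simp add: card_gt_0_iff)
  obtain k where k: "k < nat (N (Suc m))"
    "1 / (2 * real (card (B (Suc m)))) \<le> cmod (mask (B (Suc m)) ((frac u + real k) / N (Suc m)))
      * cmod ((1 + expo ((frac u + real k) / N (Suc m)) 1) / 2)"
    using mask_times_limit_large[of "B (Suc m)" "N (Suc m)" "frac u"] digits B_nonempty N_ge_2
    by (metis le_add1 plus_1_eq_Suc)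
  \<comment> \<open>The integer part of \<open>u\<close> is absorbed into the translation. As
    \<open>frac u + k\<close> stays below \<open>N (Suc m)\<close>, the point \<open>y\<close> falls
    into the unit interval, where \<open>close\<close> applies.\<close>
  define y where "y = (frac u + real k) / N (Suc m)"
  have "real k + 1 \<le> N (Suc m)"
    using k(1) by linarith
  then have y: "y \<in> {0..1}"
    using P frac_lt_1[of u] by (auto simp: y_def divide_le_eq)
  have x: "x + real_of_int (P m * (int k - \<lfloor>u\<rfloor>)) = P (Suc m) * y"
    using P by (simp add: y_def P_Suc u_def frac_def field_simps)
  have "factor (Suc m) (P (Suc m) * y) = mask (B (Suc m)) y"
    using P_pos[of "Suc m"] by (simp add: factor_def)
  then have tail: "tail_ft m (P (Suc m) * y) = mask (B (Suc m)) y * tail_ft (Suc m) (P (Suc m) * y)"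
    by (simp add: tail_ft_Suc[of m])
  have "1 / (2 * real M) \<le> 1 / (2 * real (card (B (Suc m))))"
    using M card by (intro divide_left_mono) auto
  also have "\<dots> \<le> cmod (mask (B (Suc m)) y * ((1 + expo y 1) / 2))"
    using k(2) by (simp add: y_def norm_mult)
  also have "\<dots> \<le> cmod (tail_ft m (P (Suc m) * y))
      + cmod (mask (B (Suc m)) y * (tail_ft (Suc m) (P (Suc m) * y) - (1 + expo y 1) / 2))"
    using norm_triangle_ineq4[of "tail_ft m (P (Suc m) * y)"
        "mask (B (Suc m)) y * (tail_ft (Suc m) (P (Suc m) * y) - (1 + expo y 1) / 2)"]
    by (simp add: tail right_diff_distrib)
  also have "cmod (mask (B (Suc m)) y * (tail_ft (Suc m) (P (Suc m) * y) - (1 + expo y 1) / 2)) \<le> 1 * (1 / (4 * real M))"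
    unfolding norm_mult using close[OF y] cmod_mask_le_1 by (intro mult_mono) auto
  finally have "1 / (4 * real M) \<le> cmod (tail_ft m (P (Suc m) * y))"
    by (simp add: field_simps)
  then show ?thesis
    unfolding x [symmetric] by blast
qed

section \<open>Uniform convergence of the transforms of the rescaled tails\<close>

lemma tail_ft_tendsto:
  fixes y :: real
  assumes "weak_conv_m (scaled_tail N B) (unif_measure {0, 1})"
  shows "(\<lambda>n. tail_ft n (P n * y)) \<longlonglongrightarrow> (1 + expo y 1) / 2"
proof -
  have dist: "real_distribution (tail_measure N B n)" for n
    by (rule tail_measure_props)
  have "real_distribution (scaled_tail N B n)" for n
  proof -
    interpret real_distribution "tail_measure N B n" by (rule dist)
    have "prob_space (scaled_tail N B n)"
      unfolding scaled_tail_def by (rule prob_space_distr) simp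
    then show ?thesis
      by (auto simp: real_distribution_def real_distribution_axioms_def scaled_tail_def)
  qed
  from levy_continuity1[OF this real_distribution_unif_measure assms, of "2 * pi * y"]
  have "(\<lambda>n. char (scaled_tail N B n) (2 * pi * y)) \<longlonglongrightarrow> char (unif_measure {0, 1}) (2 * pi * y)" .
  moreover have "char (unif_measure {0, 1}) (2 * pi * y) = (1 + expo y 1) / 2"
    by (subst char_unif_measure) (auto simp: expo_eq_cis cis_conv_exp)
  moreover have "char (scaled_tail N B n) (2 * pi * y) = tail_ft n (P n * y)" for n
  proof -
    interpret real_distribution "tail_measure N B n" by (rule dist)
    show ?thesis
      unfolding scaled_tail_def char_def tail_ft_def P_def [symmetric]
      by (subst integral_distr) (auto simp: mult_ac)
  qed
  ultimately show ?thesis by simp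
qed

text \<open>Pointwise convergence at finitely many grid points and equicontinuity give uniform
  convergence on a compact interval.\<close>

lemma tail_ft_uniform_limit:
  assumes conv: "\<And>y :: real. (\<lambda>n. tail_ft n (P n * y)) \<longlonglongrightarrow> (1 + expo y 1) / 2" and e: "e > 0"
  shows "\<forall>\<^sub>F n in sequentially. \<forall>y\<in>{0..1::real}. cmod (tail_ft n (P n * y) - (1 + expo y 1) / 2) \<le> e"
proof -
  define \<rho> where "\<rho> y = (1 + expo y 1) / 2" for y
  \<comment> \<open>The grid has mesh 1 / K. The Lipschitz constants 4 pi of the tails and pi of the
    limit add up to 5 pi, and 5 pi / K is below e / 2.\<close>
  obtain K :: nat where "10 * pi / e < K"
    using reals_Archimedean2 by blast
  moreover have "0 < 10 * pi / e"
    using e by simp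
  ultimately have "K > 0" "10 * pi < K * e"
    using e by (auto simp: pos_divide_less_eq intro: Nat.gr0I)
  then have K: "K > 0" "10 * pi / K < e"
    by (auto simp: pos_divide_less_eq mult.commute)
  have "\<forall>\<^sub>F n in sequentially. cmod (tail_ft n (P n * (j / K)) - \<rho> (j / K)) < e / 2" for j :: nat
    using tendstoD[OF conv[of "real j / real K"], of "e / 2"] e by (simp add: dist_norm \<rho>_def)
  then have "\<forall>\<^sub>F n in sequentially. \<forall>j\<in>{..K}. cmod (tail_ft n (P n * (j / K)) - \<rho> (j / K)) < e / 2"
    by (intro eventually_ball_finite) auto
  then have "\<forall>\<^sub>F n in sequentially. \<forall>y\<in>{0..1::real}. cmod (tail_ft n (P n * y) - \<rho> y) \<le> e"
  proof eventually_elim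
    case (elim n)
    show ?case
    proof
      fix y :: real assume y: "y \<in> {0..1}"
      define j where "j = nat \<lfloor>y * K\<rfloor>"
      have "real j \<le> y * K" "y * K \<le> real j + 1"
        using y unfolding j_def by (auto simp: of_nat_floor)
      moreover have "y * K \<le> K"
        using y K by (simp add: mult_left_le_one_le)
      ultimately have "real j \<le> K" "\<bar>y * K - j\<bar> \<le> 1"
        by linarith+
      moreover have "y - j / K = (y * K - j) / K"
        using K by (simp add: field_simps)
      ultimately have j: "j \<le> K" "\<bar>y - j / K\<bar> \<le> 1 / K"
        using K by (auto simp: abs_divide intro: divide_right_mono)
      have P: "real_of_int (P n) > 0"
        using P_pos[of n] by simp
      have "cmod (tail_ft n (P n * y) - tail_ft n (P n * (j / K))) \<le> 4 * pi * \<bar>P n * y - P n * (j / K)\<bar> / P n"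
        by (rule cmod_tail_ft_diff_le)
      also have "\<dots> = 4 * pi * \<bar>y - j / K\<bar>"
        unfolding right_diff_distrib [symmetric] abs_mult using P by simp
      finally have 1: "cmod (tail_ft n (P n * y) - tail_ft n (P n * (j / K))) \<le> 4 * pi * \<bar>y - j / K\<bar>" .
      have \<rho>_diff: "\<rho> (j / K) - \<rho> y = (expo (j / K) 1 - expo y 1) / 2"
        by (simp add: \<rho>_def diff_divide_distrib add_divide_distrib)
      have 2: "cmod (\<rho> (j / K) - \<rho> y) \<le> pi * \<bar>y - j / K\<bar>"
        unfolding \<rho>_diff using cmod_expo_diff_le[of "j / K" 1 y]
        by (simp add: norm_divide abs_minus_commute)
      have "5 * pi * \<bar>y - j / K\<bar> \<le> 5 * pi * (1 / K)"
        using j(2) by (intro mult_left_mono) auto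
      also have "\<dots> \<le> e / 2"
        using K(2) by simp
      finally have 3: "5 * pi * \<bar>y - j / K\<bar> \<le> e / 2" .
      have 4: "cmod (tail_ft n (P n * (j / K)) - \<rho> (j / K)) < e / 2"
        using elim j(1) by blast
      have split: "tail_ft n (P n * y) - \<rho> y = (tail_ft n (P n * y) - tail_ft n (P n * (j / K)))
          + (tail_ft n (P n * (j / K)) - \<rho> (j / K)) + (\<rho> (j / K) - \<rho> y)"
        by simp
      have "cmod (tail_ft n (P n * y) - \<rho> y) \<le> cmod (tail_ft n (P n * y) - tail_ft n (P n * (j / K)))
          + cmod (tail_ft n (P n * (j / K)) - \<rho> (j / K)) + cmod (\<rho> (j / K) - \<rho> y)"
        unfolding split by (intro norm_triangle_le add_mono norm_triangle_ineq order_refl)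
      also have "\<dots> \<le> e"
        using 1 2 3 4 by linarith
      finally show "cmod (tail_ft n (P n * y) - \<rho> y) \<le> e" .
    qed
  qed
  then show ?thesis
    by (simp add: \<rho>_def)
qed

end

text \<open>If each bound were eventually exceeded, the lower limit would be infinite. This yields
  the infinitely many levels at which the number of digits is bounded.\<close>

lemma liminf_enat_finite_imp_frequently_le:
  assumes "liminf (\<lambda>n. enat (f n)) < \<infinity>"
  shows "\<exists>M. \<exists>\<^sub>F n in sequentially. f n \<le> M"
proof (rule ccontr)
  assume "\<nexists>M. \<exists>\<^sub>F n in sequentially. f n \<le> M"
  then have ev: "\<forall>\<^sub>F n in sequentially. M < f n" for M
    by (simp add: not_frequently not_le)
  have "enat M \<le> liminf (\<lambda>n. enat (f n))" for M
    by (rule Liminf_bounded) (use ev[of M] in \<open>auto elim: eventually_mono\<close>)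
  then have "liminf (\<lambda>n. enat (f n)) = \<infinity>"
    by (cases "liminf (\<lambda>n. enat (f n))") (metis enat_ord_simps(1) not_less_eq_eq, simp)
  with assms show False by simp
qed

theorem theorem1p5:
  fixes N :: "nat \<Rightarrow> int" and B L :: "nat \<Rightarrow> int set"
  assumes "\<And>n. n \<ge> 1 \<Longrightarrow> hadamard_triple (N n) (B n) (L n)"
    and "\<And>n. n \<ge> 1 \<Longrightarrow> B n \<subseteq> {0..N n - 1}"
    and "weak_conv_m (scaled_tail N B) (unif_measure {0, 1})"
    and "liminf (\<lambda>n. enat (card (B n))) < \<infinity>"
  shows "spectral_measure (cantor_moran N B)"
proof -
  interpret hadamard_sequence N B L
    using assms(1,2) by unfold_locales
  obtain M0 where M0: "\<exists>\<^sub>F n in sequentially. card (B n) \<le> M0"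
    using liminf_enat_finite_imp_frequently_le[OF assms(4)] by blast
  \<comment> \<open>The successor makes \<open>M\<close> positive, so that 1 / (4 M) is a genuine
    tolerance and the final constant 1 / (8 M) is at most 1/4.\<close>
  define M where "M = Suc M0"
  have M: "\<exists>\<^sub>F n in sequentially. card (B n) \<le> M"
    using M0 by (rule frequently_elim1) (simp add: M_def)
  have uniform: "\<forall>\<^sub>F n in sequentially. \<forall>y\<in>{0..1::real}.
      cmod (tail_ft n (P n * y) - (1 + expo y 1) / 2) \<le> 1 / (4 * real M)"
    by (intro tail_ft_uniform_limit tail_ft_tendsto assms(3)) (simp add: M_def)
  have "\<exists>m\<ge>n0. \<forall>x. \<exists>k::int. 2 * (1 / (8 * real M)) \<le> cmod (tail_ft m (x + real_of_int (P m * k)))" for n0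
  proof -
    have "\<exists>\<^sub>F n in sequentially. card (B n) \<le> M \<and> (\<forall>y\<in>{0..1::real}.
        cmod (tail_ft n (P n * y) - (1 + expo y 1) / 2) \<le> 1 / (4 * real M))"
      using frequently_eventually_frequently[OF M uniform] .
    \<comment> \<open>The bounded digit set sits at level \<open>n\<close>, while equi-positivity is
      obtained one level earlier, at its predecessor; hence \<open>Suc n0\<close>.\<close>
    then obtain n where n: "n \<ge> Suc n0" "card (B n) \<le> M"
        "\<And>y :: real. y \<in> {0..1} \<Longrightarrow> cmod (tail_ft n (P n * y) - (1 + expo y 1) / 2) \<le> 1 / (4 * real M)"
      unfolding frequently_sequentially by blast
    obtain m where m: "n = Suc m"
      using n(1) by (cases n) auto
    have "\<exists>k::int. 1 / (4 * real M) \<le> cmod (tail_ft m (x + real_of_int (P m * k)))" for x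
      using n unfolding m by (intro equipositive_at) auto
    then show ?thesis
      using n(1) m by (intro exI[of _ m]) auto
  qed
  then show ?thesis
    by (intro spectral_if_equipositive[of "1 / (8 * real M)"]) (auto simp: M_def)
qed

end
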